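(* Let $G\sim\mathbb{G}(n,n,p_n)$ be a random bipartite graph with bipartition $(A_n,B_n)$, $|A_n|=|B_n|=n$, conditioned on the edge $(a,b)$ being present, where $a\in A_n$, $b\in B_n$ are fixed, and let $\kappa_n(a,b)$ be the Ricci curvature of the edge $(a,b)$ in $G$. Then: (a) If $np_n\to0$, then with probability $1-o(1)$ the edge $(a,b)$ is isolated (no other edges are incident to $a$ or $b$), and consequently $\kappa_n(a,b)=0$. (b) If $np_n\to\lambda$ with $0<\lambda<\infty$, then $\kappa_n(a,b)$ converges in distribution to $-2\left(1-\frac{1}{1+X_1}-\frac{1}{1+X_2}\right)_+$, where $X_1,X_2$ are independent Poisson($\lambda$) random variables. (c) If $np_n\to\infty$ and $np_n^2\to0$, then $\kappa_n(a,b)\to-2$ in probability. (d) If $np_n^2\to\infty$, then $\kappa_n(a,b)\to0$ in probability.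
   Context: In $\mathbb{G}(n,n,p)$ each pair in $A_n\times B_n$ is an edge independently with probability $p$. For a graph $G$, $d_G$ is the shortest-path metric, $N_G(v)$ the neighbour set and $d_v$ the degree of $v$; $m_v$ is the uniform probability measure on $N_G(v)$, and for an edge $(x,y)$ the Ricci curvature is $\kappa(x,y)=1-W_1(m_x,m_y)$, where $W_1$ is the Wasserstein-1 (transportation) distance with respect to $d_G$. $(t)_+=\max(t,0)$. *)

theory Defs
  imports "HOL-Probability.Probability"
begin

text \<open>Vertices: A_n = Inl ` {..<n}, B_n = Inr ` {..<n}.  A sample of G(n,n,p)
  is an indicator f on {..<n} x {..<n}: f (i,j) iff (Inl i, Inr j) is an edge.
  Each pair is an edge independently with probability p.\<close>

definition bip_graph_pmf :: "nat \<Rightarrow> real \<Rightarrow> (nat \<times> nat \<Rightarrow> bool) pmf" where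
  "bip_graph_pmf n p = Pi_pmf ({..<n} \<times> {..<n}) False (\<lambda>_. bernoulli_pmf p)"

definition bip_graph_cond_pmf :: "nat \<Rightarrow> real \<Rightarrow> nat \<Rightarrow> nat \<Rightarrow> (nat \<times> nat \<Rightarrow> bool) pmf" where
  "bip_graph_cond_pmf n p a b = cond_pmf (bip_graph_pmf n p) {f. f (a, b)}"

definition bip_vertices :: "nat \<Rightarrow> (nat + nat) set" where
  "bip_vertices n = Inl ` {..<n} \<union> Inr ` {..<n}"

fun bip_adj :: "nat \<Rightarrow> (nat \<times> nat \<Rightarrow> bool) \<Rightarrow> nat + nat \<Rightarrow> nat + nat \<Rightarrow> bool" where
  "bip_adj n f (Inl i) (Inr j) = (i < n \<and> j < n \<and> f (i, j))"
| "bip_adj n f (Inr j) (Inl i) = (i < n \<and> j < n \<and> f (i, j))"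
| "bip_adj n f _ _ = False"

definition nbrs :: "('v \<Rightarrow> 'v \<Rightarrow> bool) \<Rightarrow> 'v \<Rightarrow> 'v set" where
  "nbrs E v = {u. E v u}"

definition degree :: "('v \<Rightarrow> 'v \<Rightarrow> bool) \<Rightarrow> 'v \<Rightarrow> nat" where
  "degree E v = card (nbrs E v)"

text \<open>Shortest-path distance: least k such that there is a walk of length k.
  (Only ever used between vertices at distance at most 3.)\<close>
definition gdist :: "('v \<Rightarrow> 'v \<Rightarrow> bool) \<Rightarrow> 'v \<Rightarrow> 'v \<Rightarrow> nat" where
  "gdist E u v = (LEAST k. (E ^^ k) u v)"

definition unif_nbr :: "('v \<Rightarrow> 'v \<Rightarrow> bool) \<Rightarrow> 'v \<Rightarrow> 'v \<Rightarrow> real" where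
  "unif_nbr E v u = (if E v u then 1 / real (degree E v) else 0)"

definition wasserstein1 :: "'v set \<Rightarrow> ('v \<Rightarrow> 'v \<Rightarrow> real) \<Rightarrow> ('v \<Rightarrow> real) \<Rightarrow> ('v \<Rightarrow> real) \<Rightarrow> real" where
  "wasserstein1 V d \<mu> \<nu> = Inf {(\<Sum>(u, v)\<in>V \<times> V. \<pi> (u, v) * d u v) | \<pi>.
      (\<forall>z. 0 \<le> \<pi> z) \<and>
      (\<forall>u\<in>V. (\<Sum>v\<in>V. \<pi> (u, v)) = \<mu> u) \<and>
      (\<forall>v\<in>V. (\<Sum>u\<in>V. \<pi> (u, v)) = \<nu> v)}"

definition ricci :: "'v set \<Rightarrow> ('v \<Rightarrow> 'v \<Rightarrow> bool) \<Rightarrow> 'v \<Rightarrow> 'v \<Rightarrow> real" where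
  "ricci V E x y = 1 - wasserstein1 V (\<lambda>u v. real (gdist E u v)) (unif_nbr E x) (unif_nbr E y)"

definition kappa :: "nat \<Rightarrow> nat \<Rightarrow> nat \<Rightarrow> (nat \<times> nat \<Rightarrow> bool) \<Rightarrow> real" where
  "kappa n a b f = ricci (bip_vertices n) (bip_adj n f) (Inl a) (Inr b)"

definition edge_isolated :: "nat \<Rightarrow> nat \<Rightarrow> nat \<Rightarrow> (nat \<times> nat \<Rightarrow> bool) \<Rightarrow> bool" where
  "edge_isolated n a b f =
     ((\<forall>j<n. f (a, j) \<longrightarrow> j = b) \<and> (\<forall>i<n. f (i, b) \<longrightarrow> i = a))"

end

theory Submission
  imports Defs
begin

text \<open>
  A neighbour of \<open>a\<close> and a neighbour of \<open>b\<close> are at distance 1 if they are adjacent and 3 otherwise,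
  so \<open>\<kappa> = - 2 * (1 - M)\<close> where \<open>M\<close> is the largest mass that a coupling can put on adjacent pairs.
  Pairs that contain \<open>a\<close> or \<open>b\<close> are always adjacent and carry at most \<open>1 / d\<^sub>a + 1 / d\<^sub>b\<close>; the other
  adjacent pairs are the cross edges between the remaining neighbours, of which about
  \<open>n\<^sup>2 p\<^sup>3\<close> are expected.

  If \<open>n p\<close> is bounded there are no cross edges with high probability, and then
  \<open>M = min 1 (1 / d\<^sub>a + 1 / d\<^sub>b)\<close>; the degrees \<open>d\<^sub>a - 1\<close> and \<open>d\<^sub>b - 1\<close> are independent binomial, hence
  asymptotically Poisson. If \<open>n p \<rightarrow> \<infinity>\<close> and \<open>n p\<^sup>2 \<rightarrow> 0\<close>, the cross edges carry at most their number
  divided by \<open>d\<^sub>a\<close>, about \<open>n p\<^sup>2\<close>. If \<open>n p\<^sup>2 \<rightarrow> \<infinity>\<close>, the cross edges form a nearly biregular graph by a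
  second moment estimate, so a truncation of the uniform weight on them is a subcoupling of
  mass close to 1.
\<close>

section \<open>Transport with distances 1 and 3\<close>

definition couplings :: "'v set \<Rightarrow> ('v \<Rightarrow> real) \<Rightarrow> ('v \<Rightarrow> real) \<Rightarrow> ('v \<times> 'v \<Rightarrow> real) set" where
  "couplings V \<mu> \<nu> = {\<pi>. (\<forall>z. 0 \<le> \<pi> z) \<and>
      (\<forall>u\<in>V. (\<Sum>v\<in>V. \<pi> (u, v)) = \<mu> u) \<and> (\<forall>v\<in>V. (\<Sum>u\<in>V. \<pi> (u, v)) = \<nu> v)}"

lemma wasserstein1_eq_Inf_couplings:
  "wasserstein1 V d \<mu> \<nu> =
     Inf ((\<lambda>\<pi>. \<Sum>u\<in>V. \<Sum>v\<in>V. \<pi> (u, v) * d u v) ` couplings V \<mu> \<nu>)"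
  unfolding wasserstein1_def couplings_def
  by (rule arg_cong[where f = Inf]) (auto simp: sum.cartesian_product)

text \<open>For an edge of a bipartite graph, two neighbours of its endpoints (one of each) are at
  distance 1 or 3; \<open>R\<close> is adjacency.\<close>

locale transport_1_3 =
  fixes V :: "'v set" and d :: "'v \<Rightarrow> 'v \<Rightarrow> real" and \<mu> \<nu> :: "'v \<Rightarrow> real"
    and R :: "'v \<Rightarrow> 'v \<Rightarrow> bool"
  assumes fin: "finite V"
    and mu_nonneg: "\<And>u. 0 \<le> \<mu> u" and nu_nonneg: "\<And>v. 0 \<le> \<nu> v"
    and sum_mu: "sum \<mu> V = 1" and sum_nu: "sum \<nu> V = 1"
    and d_nonneg: "\<And>u v. 0 \<le> d u v"
    and d_supp: "\<And>u v. u \<in> V \<Longrightarrow> v \<in> V \<Longrightarrow> \<mu> u \<noteq> 0 \<Longrightarrow> \<nu> v \<noteq> 0 \<Longrightarrow>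
                   d u v = (if R u v then 1 else 3)"
begin

lemma coupling_le:
  assumes "\<pi> \<in> couplings V \<mu> \<nu>" "u \<in> V" "v \<in> V"
  shows "\<pi> (u, v) \<le> \<mu> u" "\<pi> (u, v) \<le> \<nu> v"
proof -
  have "\<pi> (u, v) \<le> (\<Sum>v\<in>V. \<pi> (u, v))"
    by (rule member_le_sum) (use assms fin in \<open>auto simp: couplings_def\<close>)
  moreover have "\<pi> (u, v) \<le> (\<Sum>u\<in>V. \<pi> (u, v))"
    by (rule member_le_sum[where f = "\<lambda>u. \<pi> (u, v)"]) (use assms fin in \<open>auto simp: couplings_def\<close>)
  ultimately show "\<pi> (u, v) \<le> \<mu> u" "\<pi> (u, v) \<le> \<nu> v"
    using assms by (auto simp: couplings_def)
qed

lemma coupling_total: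
  assumes "\<pi> \<in> couplings V \<mu> \<nu>"
  shows "(\<Sum>u\<in>V. \<Sum>v\<in>V. \<pi> (u, v)) = 1"
  using assms sum_mu by (simp add: couplings_def)

text \<open>Wherever a coupling has mass, the distance is 3 minus twice the adjacency indicator, and
  the total mass is 1. Minimising the cost thus means maximising the mass on adjacent pairs.\<close>

lemma coupling_cost:
  assumes "\<pi> \<in> couplings V \<mu> \<nu>"
  shows "(\<Sum>u\<in>V. \<Sum>v\<in>V. \<pi> (u, v) * d u v)
           = 3 - 2 * (\<Sum>u\<in>V. \<Sum>v\<in>V. \<pi> (u, v) * of_bool (R u v))"
proof -
  \<comment> \<open>The distance is prescribed only between the two supports; off them the marginals
    force the entry of the coupling to vanish.\<close>
  have "\<pi> (u, v) * d u v = 3 * \<pi> (u, v) - 2 * (\<pi> (u, v) * of_bool (R u v))"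
    if "u \<in> V" "v \<in> V" for u v
  proof (cases "\<mu> u = 0 \<or> \<nu> v = 0")
    case True
    then have "\<pi> (u, v) = 0"
      using coupling_le[OF assms that] assms
      by (auto simp: couplings_def intro: antisym)
    then show ?thesis by simp
  next
    case False
    then show ?thesis using d_supp[OF that] by simp
  qed
  then have "(\<Sum>u\<in>V. \<Sum>v\<in>V. \<pi> (u, v) * d u v)
      = (\<Sum>u\<in>V. \<Sum>v\<in>V. 3 * \<pi> (u, v) - 2 * (\<pi> (u, v) * of_bool (R u v)))"
    by simp
  also have "\<dots> = 3 * (\<Sum>u\<in>V. \<Sum>v\<in>V. \<pi> (u, v))
                   - 2 * (\<Sum>u\<in>V. \<Sum>v\<in>V. \<pi> (u, v) * of_bool (R u v))"
    by (simp add: sum_subtractf flip: sum_distrib_left)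
  finally show ?thesis using coupling_total[OF assms] by simp
qed

text \<open>Both residual marginals have mass \<open>1 - M\<close>, so their normalised product
  fills the gap exactly. Constructions of transport plans then need only inequalities on the
  marginals.\<close>

lemma subcoupling_extends:
  assumes w: "\<And>z. 0 \<le> w z" "\<And>u. u \<in> V \<Longrightarrow> (\<Sum>v\<in>V. w (u, v)) \<le> \<mu> u"
    "\<And>v. v \<in> V \<Longrightarrow> (\<Sum>u\<in>V. w (u, v)) \<le> \<nu> v"
  obtains \<pi> where "\<pi> \<in> couplings V \<mu> \<nu>" "\<And>z. z \<in> V \<times> V \<Longrightarrow> w z \<le> \<pi> z"
proof -
  define M where "M = (\<Sum>u\<in>V. \<Sum>v\<in>V. w (u, v))"
  have M': "M = (\<Sum>v\<in>V. \<Sum>u\<in>V. w (u, v))"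
    unfolding M_def by (rule sum.swap)
  define r where "r u = \<mu> u - (\<Sum>v\<in>V. w (u, v))" for u
  define s where "s v = \<nu> v - (\<Sum>u\<in>V. w (u, v))" for v
  have r0: "0 \<le> r u" if "u \<in> V" for u using w(2)[OF that] by (simp add: r_def)
  have s0: "0 \<le> s u" if "u \<in> V" for u using w(3)[OF that] by (simp add: s_def)
  have rs: "sum r V = 1 - M" "sum s V = 1 - M"
    by (simp_all add: r_def s_def sum_subtractf sum_mu sum_nu M_def[symmetric] M'[symmetric])
  have M1: "M \<le> 1" using sum_nonneg[of V r] r0 rs by auto
  \<comment> \<open>The residual masses are coupled independently; if \<open>M = 1\<close> they vanish and so does
    the junk value of the division.\<close>
  define \<pi> where "\<pi> z = (if z \<in> V \<times> V then w z + r (fst z) * s (snd z) / (1 - M) else 0)" for z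
  have q: "r u * (1 - M) / (1 - M) = r u" "s u * (1 - M) / (1 - M) = s u" if "u \<in> V" for u
  proof -
    have "r u = 0 \<and> s u = 0" if "M = 1"
      using sum_nonneg_eq_0_iff[OF fin r0] sum_nonneg_eq_0_iff[OF fin s0] rs that \<open>u \<in> V\<close> by auto
    then show "r u * (1 - M) / (1 - M) = r u" "s u * (1 - M) / (1 - M) = s u" by auto
  qed
  have "(\<Sum>v\<in>V. \<pi> (u, v)) = \<mu> u" if u: "u \<in> V" for u
  proof -
    have "(\<Sum>v\<in>V. \<pi> (u, v)) = (\<Sum>v\<in>V. w (u, v)) + r u * sum s V / (1 - M)"
      using u by (simp add: \<pi>_def sum.distrib sum_distrib_left sum_divide_distrib)
    then show ?thesis using q[OF u] by (simp add: rs r_def)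
  qed
  moreover have "(\<Sum>u\<in>V. \<pi> (u, v)) = \<nu> v" if v: "v \<in> V" for v
  proof -
    have "(\<Sum>u\<in>V. \<pi> (u, v)) = (\<Sum>u\<in>V. w (u, v)) + s v * sum r V / (1 - M)"
      using v by (simp add: \<pi>_def sum.distrib sum_distrib_left sum_divide_distrib mult.commute)
    then show ?thesis using q[OF v] by (simp add: rs s_def)
  qed
  ultimately have "\<pi> \<in> couplings V \<mu> \<nu>"
    using w(1) r0 s0 M1 by (auto simp: couplings_def \<pi>_def intro!: add_nonneg_nonneg)
  moreover have "w z \<le> \<pi> z" if "z \<in> V \<times> V" for z
    using that r0 s0 M1 by (auto simp: \<pi>_def)
  ultimately show thesis by (rule that)
qed

lemma couplings_nonempty: "couplings V \<mu> \<nu> \<noteq> {}"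
  using subcoupling_extends[of "\<lambda>_. 0"] mu_nonneg nu_nonneg by auto

text \<open>The extension to a coupling only adds mass, so the adjacent mass is at least that of
  \<open>w\<close>. The mass added on non-adjacent pairs is already charged with cost 3.\<close>

lemma wasserstein1_le_of_subcoupling:
  assumes w: "\<And>z. 0 \<le> w z" "\<And>u. u \<in> V \<Longrightarrow> (\<Sum>v\<in>V. w (u, v)) \<le> \<mu> u"
    "\<And>v. v \<in> V \<Longrightarrow> (\<Sum>u\<in>V. w (u, v)) \<le> \<nu> v"
    and R: "\<And>u v. u \<in> V \<Longrightarrow> v \<in> V \<Longrightarrow> w (u, v) \<noteq> 0 \<Longrightarrow> R u v"
  shows "wasserstein1 V d \<mu> \<nu> \<le> 3 - 2 * (\<Sum>u\<in>V. \<Sum>v\<in>V. w (u, v))"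
proof -
  obtain \<pi> where \<pi>: "\<pi> \<in> couplings V \<mu> \<nu>" "\<And>z. z \<in> V \<times> V \<Longrightarrow> w z \<le> \<pi> z"
    using subcoupling_extends[OF w] by blast
  have "wasserstein1 V d \<mu> \<nu> \<le> (\<Sum>u\<in>V. \<Sum>v\<in>V. \<pi> (u, v) * d u v)"
    unfolding wasserstein1_eq_Inf_couplings
  proof (rule cInf_lower)
    show "bdd_below ((\<lambda>\<pi>. \<Sum>u\<in>V. \<Sum>v\<in>V. \<pi> (u, v) * d u v) ` couplings V \<mu> \<nu>)"
      by (rule bdd_belowI2[where m = 0])
         (auto simp: couplings_def d_nonneg intro!: sum_nonneg mult_nonneg_nonneg)
  qed (use \<pi> in auto)
  also have "\<dots> = 3 - 2 * (\<Sum>u\<in>V. \<Sum>v\<in>V. \<pi> (u, v) * of_bool (R u v))"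
    by (rule coupling_cost[OF \<pi>(1)])
  also have "\<dots> \<le> 3 - 2 * (\<Sum>u\<in>V. \<Sum>v\<in>V. w (u, v))"
  proof -
    have "w (u, v) \<le> \<pi> (u, v) * of_bool (R u v)" if "u \<in> V" "v \<in> V" for u v
      using \<pi>(2)[of "(u, v)"] R[OF that] w(1)[of "(u, v)"] that by (cases "R u v") auto
    then show ?thesis by (auto intro!: sum_mono)
  qed
  finally show ?thesis .
qed

text \<open>\<open>coupling_cost\<close> turns an upper bound on the adjacent mass into a lower
  bound on every cost. Nonemptiness of the set of couplings makes the real infimum
  meaningful.\<close>

lemma wasserstein1_ge:
  assumes "\<And>\<pi>. \<pi> \<in> couplings V \<mu> \<nu> \<Longrightarrow> (\<Sum>u\<in>V. \<Sum>v\<in>V. \<pi> (u, v) * of_bool (R u v)) \<le> B"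
  shows "3 - 2 * B \<le> wasserstein1 V d \<mu> \<nu>"
  unfolding wasserstein1_eq_Inf_couplings
proof (rule cInf_greatest)
  show "3 - 2 * B \<le> c"
    if "c \<in> (\<lambda>\<pi>. \<Sum>u\<in>V. \<Sum>v\<in>V. \<pi> (u, v) * d u v) ` couplings V \<mu> \<nu>" for c
    using that assms coupling_cost by fastforce
qed (use couplings_nonempty in auto)

lemma wasserstein1_ge_1: "1 \<le> wasserstein1 V d \<mu> \<nu>"
proof -
  have "(\<Sum>u\<in>V. \<Sum>v\<in>V. \<pi> (u, v) * of_bool (R u v)) \<le> 1" if "\<pi> \<in> couplings V \<mu> \<nu>" for \<pi>
  proof -
    have "(\<Sum>u\<in>V. \<Sum>v\<in>V. \<pi> (u, v) * of_bool (R u v)) \<le> (\<Sum>u\<in>V. \<Sum>v\<in>V. \<pi> (u, v))"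
      using that by (intro sum_mono) (auto simp: couplings_def)
    then show ?thesis using coupling_total[OF that] by simp
  qed
  from wasserstein1_ge[OF this] show ?thesis by simp
qed

text \<open>The row of \<open>y\<close> carries at most \<open>\<mu> y\<close> and the column of
  \<open>x\<close> at most \<open>\<nu> x\<close>; any other adjacent pair carries at most
  \<open>\<mu> u\<close>, and nothing where \<open>\<nu>\<close> vanishes. In the application
  \<open>x\<close> and \<open>y\<close> are the endpoints of the edge, which are adjacent to
  everything in the opposite support.\<close>

lemma wasserstein1_ge_punctured:
  assumes xy: "x \<in> V" "y \<in> V"
  shows "3 - 2 * (\<mu> y + \<nu> x + (\<Sum>u\<in>V - {y}. \<Sum>v\<in>V - {x}. \<mu> u * of_bool (R u v \<and> \<nu> v \<noteq> 0)))
           \<le> wasserstein1 V d \<mu> \<nu>"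
proof (rule wasserstein1_ge)
  fix \<pi> assume \<pi>: "\<pi> \<in> couplings V \<mu> \<nu>"
  let ?c = "\<lambda>u v. \<pi> (u, v) * of_bool (R u v)"
  have c0: "0 \<le> ?c u v" "?c u v \<le> \<pi> (u, v)" for u v using \<pi> by (auto simp: couplings_def)
  have c\<mu>: "?c u v \<le> \<mu> u * of_bool (R u v \<and> \<nu> v \<noteq> 0)" if "u \<in> V" "v \<in> V" for u v
    using coupling_le[OF \<pi> that] \<pi> mu_nonneg[of u] by (auto simp: couplings_def)
  have row: "(\<Sum>v\<in>V. ?c y v) \<le> \<mu> y"
    using sum_mono[of V "?c y" "\<lambda>v. \<pi> (y, v)"] c0 \<pi> xy by (auto simp: couplings_def)
  have col: "(\<Sum>u\<in>V. ?c u x) \<le> \<nu> x"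
    using sum_mono[of V "\<lambda>u. ?c u x" "\<lambda>u. \<pi> (u, x)"] c0 \<pi> xy by (auto simp: couplings_def)
  have "(\<Sum>u\<in>V. \<Sum>v\<in>V. ?c u v) = (\<Sum>v\<in>V. ?c y v) + (\<Sum>u\<in>V - {y}. \<Sum>v\<in>V. ?c u v)"
    by (rule sum.remove) (use fin xy in auto)
  also have "(\<Sum>u\<in>V - {y}. \<Sum>v\<in>V. ?c u v)
      = (\<Sum>u\<in>V - {y}. ?c u x + (\<Sum>v\<in>V - {x}. ?c u v))"
    by (rule sum.cong[OF refl], rule sum.remove) (use fin xy in auto)
  also have "\<dots> = (\<Sum>u\<in>V - {y}. ?c u x) + (\<Sum>u\<in>V - {y}. \<Sum>v\<in>V - {x}. ?c u v)"
    by (rule sum.distrib)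
  also have "(\<Sum>u\<in>V - {y}. ?c u x) \<le> (\<Sum>u\<in>V. ?c u x)"
    by (rule sum_mono2) (use fin c0 in auto)
  also have "(\<Sum>u\<in>V - {y}. \<Sum>v\<in>V - {x}. ?c u v)
      \<le> (\<Sum>u\<in>V - {y}. \<Sum>v\<in>V - {x}. \<mu> u * of_bool (R u v \<and> \<nu> v \<noteq> 0))"
    by (intro sum_mono c\<mu>) auto
  finally show "(\<Sum>u\<in>V. \<Sum>v\<in>V. ?c u v)
      \<le> \<mu> y + \<nu> x + (\<Sum>u\<in>V - {y}. \<Sum>v\<in>V - {x}. \<mu> u * of_bool (R u v \<and> \<nu> v \<noteq> 0))"
    using row col by linarith
qed

end

section \<open>Curvature of an edge of a bipartite graph\<close>

text \<open>The left endpoint \<open>a\<close> has its neighbours on the right, so \<open>other_nbrs_left\<close> consists of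
  right indices, and conversely.\<close>

definition other_nbrs_left :: "nat \<Rightarrow> nat \<Rightarrow> nat \<Rightarrow> (nat \<times> nat \<Rightarrow> bool) \<Rightarrow> nat set" where
  "other_nbrs_left n a b f = {j \<in> {..<n} - {b}. f (a, j)}"

definition other_nbrs_right :: "nat \<Rightarrow> nat \<Rightarrow> nat \<Rightarrow> (nat \<times> nat \<Rightarrow> bool) \<Rightarrow> nat set" where
  "other_nbrs_right n a b f = {i \<in> {..<n} - {a}. f (i, b)}"

text \<open>Each such pair closes a 4-cycle a, j, i, b, so this counts the 4-cycles through the edge
  (a, b).\<close>

definition cross_edges :: "nat \<Rightarrow> nat \<Rightarrow> nat \<Rightarrow> (nat \<times> nat \<Rightarrow> bool) \<Rightarrow> real" where
  "cross_edges n a b f =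
     (\<Sum>j\<in>other_nbrs_left n a b f. \<Sum>i\<in>other_nbrs_right n a b f. of_bool (f (i, j)))"

text \<open>The deterministic part: one fixed graph containing the edge. The random graph meets
  these assumptions at every point of its support.\<close>

locale bip_edge =
  fixes n a b :: nat and f :: "nat \<times> nat \<Rightarrow> bool"
  assumes a_less: "a < n" and b_less: "b < n" and edge: "f (a, b)"
begin

abbreviation "E \<equiv> bip_adj n f"
abbreviation "V \<equiv> bip_vertices n"
abbreviation "S \<equiv> other_nbrs_left n a b f"
abbreviation "T \<equiv> other_nbrs_right n a b f"

lemma finite_ST [simp]: "finite S" "finite T"
  by (auto simp: other_nbrs_left_def other_nbrs_right_def)

lemma notin_ST [simp]: "b \<notin> S" "a \<notin> T"
  by (auto simp: other_nbrs_left_def other_nbrs_right_def)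

lemma adj_iff:
  "E (Inl a) v \<longleftrightarrow> v \<in> Inr ` insert b S" "E (Inr b) v \<longleftrightarrow> v \<in> Inl ` insert a T"
  using a_less b_less edge
  by (cases v; auto simp: other_nbrs_left_def other_nbrs_right_def)+

lemma nbrs_eq: "nbrs E (Inl a) = Inr ` insert b S" "nbrs E (Inr b) = Inl ` insert a T"
  by (auto simp: nbrs_def adj_iff)

lemma unif_nbr_eq:
  "unif_nbr E (Inl a) v = of_bool (v \<in> Inr ` insert b S) / (1 + real (card S))"
  "unif_nbr E (Inr b) v = of_bool (v \<in> Inl ` insert a T) / (1 + real (card T))"
proof -
  have "card (Inr ` insert b S :: (nat + nat) set) = 1 + card S"
    by (subst card_image) auto
  moreover have "card (Inl ` insert a T :: (nat + nat) set) = 1 + card T"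
    by (subst card_image) auto
  ultimately show
    "unif_nbr E (Inl a) v = of_bool (v \<in> Inr ` insert b S) / (1 + real (card S))"
    "unif_nbr E (Inr b) v = of_bool (v \<in> Inl ` insert a T) / (1 + real (card T))"
    by (simp_all add: unif_nbr_def degree_def nbrs_eq adj_iff del: image_insert)
qed

lemma finite_V: "finite V"
  by (simp add: bip_vertices_def)

lemma sum_V_Inr: "sum g V = (\<Sum>j\<in>J. g (Inr j))"
  if "J \<subseteq> {..<n}" "\<And>v. v \<in> V \<Longrightarrow> v \<notin> Inr ` J \<Longrightarrow> g v = 0" for g :: "nat + nat \<Rightarrow> real"
proof -
  have "sum g V = sum g (Inr ` J)"
    by (rule sum.mono_neutral_right) (use that finite_V in \<open>auto simp: bip_vertices_def\<close>)
  then show ?thesis by (simp add: sum.reindex)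
qed

lemma sum_V_Inl: "sum g V = (\<Sum>i\<in>I. g (Inl i))"
  if "I \<subseteq> {..<n}" "\<And>v. v \<in> V \<Longrightarrow> v \<notin> Inl ` I \<Longrightarrow> g v = 0" for g :: "nat + nat \<Rightarrow> real"
proof -
  have "sum g V = sum g (Inl ` I)"
    by (rule sum.mono_neutral_right) (use that finite_V in \<open>auto simp: bip_vertices_def\<close>)
  then show ?thesis by (simp add: sum.reindex)
qed

lemma ST_subset: "insert b S \<subseteq> {..<n}" "insert a T \<subseteq> {..<n}"
  using a_less b_less by (auto simp: other_nbrs_left_def other_nbrs_right_def)

text \<open>The walk j, a, b, i has length 3, and in a bipartite graph no walk of length 0 or 2
  joins a right vertex to a left one. Walks may repeat vertices, so j = b or i = a needs no separate
  treatment.\<close>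

lemma gdist_nbrs:
  assumes "j \<in> insert b S" "i \<in> insert a T"
  shows "gdist E (Inr j) (Inl i) = (if f (i, j) then 1 else 3)"
proof -
  have lt: "i < n" "j < n" using assms ST_subset by auto
  have aj: "E (Inr j) (Inl a)" "E (Inr b) (Inl i)" "E (Inl a) (Inr b)"
    using assms a_less b_less edge by (auto simp: other_nbrs_left_def other_nbrs_right_def)
  have 0: "\<not> (E ^^ 0) (Inr j) (Inl i)" by simp
  have 1: "(E ^^ Suc 0) (Inr j) (Inl i) \<longleftrightarrow> f (i, j)"
    using lt by auto
  have 2: "\<not> (E ^^ Suc (Suc 0)) (Inr j) (Inl i)"
  proof
    assume "(E ^^ Suc (Suc 0)) (Inr j) (Inl i)"
    then obtain v where "E (Inr j) v" "E v (Inl i)" by auto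
    then show False by (cases v) auto
  qed
  have "(E ^^ Suc 0) (Inr j) (Inl a)" using relpowp_0_I aj(1) by (rule relpowp_Suc_I)
  then have "(E ^^ Suc (Suc 0)) (Inr j) (Inr b)" using aj(3) by (rule relpowp_Suc_I)
  then have 3: "(E ^^ Suc (Suc (Suc 0))) (Inr j) (Inl i)" using aj(2) by (rule relpowp_Suc_I)
  show ?thesis
  proof (cases "f (i, j)")
    case True
    then have "gdist E (Inr j) (Inl i) = 1"
      unfolding gdist_def
      by (intro Least_equality) (use 0 1 in \<open>auto simp: Suc_le_eq intro!: gr0I\<close>)
    then show ?thesis using True by simp
  next
    case False
    have "gdist E (Inr j) (Inl i) = Suc (Suc (Suc 0))"
      unfolding gdist_def
    proof (intro Least_equality 3)
      fix k assume k: "(E ^^ k) (Inr j) (Inl i)"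
      show "Suc (Suc (Suc 0)) \<le> k"
      proof (rule ccontr)
        assume "\<not> ?thesis"
        then have "k = 0 \<or> k = Suc 0 \<or> k = Suc (Suc 0)" by auto
        then show False using 0 1 2 k False by metis
      qed
    qed
    then show ?thesis using False by simp
  qed
qed

text \<open>Mass moves from the neighbours of \<open>a\<close>, which are right vertices, to those
  of \<open>b\<close>, which are left vertices. Hence transport weights below take the right index
  \<open>j\<close> first, while \<open>f (i, j)\<close> takes the left index first.\<close>

sublocale transport_1_3 V "\<lambda>u v. real (gdist E u v)" "unif_nbr E (Inl a)" "unif_nbr E (Inr b)" E
proof
  have "sum (unif_nbr E (Inl a)) V = (\<Sum>j\<in>insert b S. unif_nbr E (Inl a) (Inr j))"
    by (rule sum_V_Inr[OF ST_subset(1)]) (simp add: unif_nbr_eq)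
  then show "sum (unif_nbr E (Inl a)) V = 1"
    by (simp add: unif_nbr_eq add_divide_distrib[symmetric])
  have "sum (unif_nbr E (Inr b)) V = (\<Sum>i\<in>insert a T. unif_nbr E (Inr b) (Inl i))"
    by (rule sum_V_Inl[OF ST_subset(2)]) (simp add: unif_nbr_eq)
  then show "sum (unif_nbr E (Inr b)) V = 1"
    by (simp add: unif_nbr_eq add_divide_distrib[symmetric])
  fix u v assume "unif_nbr E (Inl a) u \<noteq> 0" "unif_nbr E (Inr b) v \<noteq> 0"
  then obtain j i where ji: "u = Inr j" "j \<in> insert b S" "v = Inl i" "i \<in> insert a T"
    unfolding unif_nbr_eq by (auto simp: of_bool_def split: if_splits)
  then have "i < n" "j < n" using ST_subset by auto
  then show "real (gdist E u v) = (if E u v then 1 else 3)"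
    using gdist_nbrs[of j i] ji by auto
qed (auto simp: unif_nbr_eq finite_V)

section \<open>Upper and lower bounds for the curvature of a fixed graph\<close>

lemma kappa_eq_wasserstein:
  "kappa n a b f =
     1 - wasserstein1 V (\<lambda>u v. real (gdist E u v)) (unif_nbr E (Inl a)) (unif_nbr E (Inr b))"
  by (simp add: kappa_def ricci_def)

lemma kappa_nonpos: "kappa n a b f \<le> 0"
  using wasserstein1_ge_1 by (simp add: kappa_eq_wasserstein)

text \<open>This is \<open>wasserstein1_ge_punctured\<close> at the endpoints \<open>a\<close> and
  \<open>b\<close>. After removing them, the adjacent pairs in the supports are exactly the cross
  edges, each of mass at most \<open>1 / (1 + card S)\<close>.\<close>

lemma kappa_le:
  "kappa n a b f \<le> - 2 + 2 * ((1 + cross_edges n a b f) / (1 + real (card S))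
                              + 1 / (1 + real (card T)))"
proof -
  let ?\<mu> = "unif_nbr E (Inl a)" and ?\<nu> = "unif_nbr E (Inr b)"
  let ?g = "\<lambda>u v. ?\<mu> u * of_bool (E u v \<and> ?\<nu> v \<noteq> 0)"
  \<comment> \<open>The puncture is written as indicator factors, because \<open>sum_V_Inr\<close>
    and \<open>sum_V_Inl\<close> collapse only sums over all of \<open>V\<close>.\<close>
  let ?g' = "\<lambda>u v. of_bool (u \<noteq> Inr b) * (of_bool (v \<noteq> Inl a) * ?g u v)"
  have "(\<Sum>u\<in>V - {Inr b}. \<Sum>v\<in>V - {Inl a}. ?g u v)
      = (\<Sum>u\<in>V - {Inr b}. \<Sum>v\<in>V - {Inl a}. ?g' u v)"
    by (intro sum.cong) auto
  also have "\<dots> = (\<Sum>u\<in>V - {Inr b}. \<Sum>v\<in>V. ?g' u v)"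
    by (intro sum.cong[OF refl] sum.mono_neutral_left) (auto simp: finite_V)
  also have "\<dots> = (\<Sum>u\<in>V. \<Sum>v\<in>V. ?g' u v)"
    by (intro sum.mono_neutral_left) (auto simp: finite_V)
  also have "\<dots> = (\<Sum>j\<in>S. \<Sum>v\<in>V. ?g' (Inr j) v)"
    by (rule sum_V_Inr) (use ST_subset in \<open>auto simp: unif_nbr_eq\<close>)
  also have "\<dots> = (\<Sum>j\<in>S. \<Sum>i\<in>T. ?g' (Inr j) (Inl i))"
    by (intro sum.cong refl sum_V_Inl) (use ST_subset in \<open>auto simp: unif_nbr_eq\<close>)
  also have "\<dots> = (\<Sum>j\<in>S. \<Sum>i\<in>T. of_bool (f (i, j)) / (1 + real (card S)))"
  proof (intro sum.cong refl)
    fix j i assume "j \<in> S" "i \<in> T"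
    moreover from this have "i < n" "j < n" "j \<noteq> b" "i \<noteq> a" using ST_subset notin_ST by auto
    ultimately show "?g' (Inr j) (Inl i) = of_bool (f (i, j)) / (1 + real (card S))"
      by (auto simp: unif_nbr_eq)
  qed
  also have "\<dots> = cross_edges n a b f / (1 + real (card S))"
    by (simp only: cross_edges_def sum_divide_distrib)
  finally have g: "(\<Sum>u\<in>V - {Inr b}. \<Sum>v\<in>V - {Inl a}. ?g u v)
      = cross_edges n a b f / (1 + real (card S))" .
  have "Inl a \<in> V" "Inr b \<in> V" using a_less b_less by (auto simp: bip_vertices_def)
  from wasserstein1_ge_punctured[OF this] show ?thesis
    unfolding g by (simp add: kappa_eq_wasserstein unif_nbr_eq add_divide_distrib)
qed

text \<open>Index form of \<open>wasserstein1_le_of_subcoupling\<close>: \<open>w\<close> is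
  extended by zero to all pairs of vertices, so that later constructions handle indices
  only.\<close>

lemma kappa_ge_of_subcoupling:
  assumes w0: "\<And>j i. 0 \<le> w j i"
    and row: "\<And>j. j \<in> insert b S \<Longrightarrow> (\<Sum>i\<in>insert a T. w j i) \<le> 1 / (1 + real (card S))"
    and col: "\<And>i. i \<in> insert a T \<Longrightarrow> (\<Sum>j\<in>insert b S. w j i) \<le> 1 / (1 + real (card T))"
    and supp: "\<And>j i. j \<in> insert b S \<Longrightarrow> i \<in> insert a T \<Longrightarrow> w j i \<noteq> 0 \<Longrightarrow> f (i, j)"
  shows "kappa n a b f \<ge> - 2 + 2 * (\<Sum>j\<in>insert b S. \<Sum>i\<in>insert a T. w j i)"
proof -
  define w' :: "(nat + nat) \<times> (nat + nat) \<Rightarrow> real" where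
    "w' z = (case z of (Inr j, Inl i) \<Rightarrow> if j \<in> insert b S \<and> i \<in> insert a T then w j i else 0
                     | _ \<Rightarrow> 0)" for z
  have w'_eq: "w' (Inr j, Inl i) = w j i" if "j \<in> insert b S" "i \<in> insert a T" for i j
    using that by (auto simp: w'_def)
  have w'_0: "w' (u, v) = 0" if "u \<notin> Inr ` insert b S \<or> v \<notin> Inl ` insert a T" for u v
    using that by (auto simp: w'_def split: sum.splits)
  have w'_nonneg: "0 \<le> w' z" for z
    by (auto simp: w'_def w0 split: sum.splits prod.splits)
  have row': "(\<Sum>v\<in>V. w' (Inr j, v)) = (\<Sum>i\<in>insert a T. w j i)" if "j \<in> insert b S" for j
  proof -
    have "(\<Sum>v\<in>V. w' (Inr j, v)) = (\<Sum>i\<in>insert a T. w' (Inr j, Inl i))"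
      by (rule sum_V_Inl[OF ST_subset(2)]) (simp add: w'_0 del: image_insert)
    then show ?thesis using w'_eq[OF that] by simp
  qed
  have col': "(\<Sum>u\<in>V. w' (u, Inl i)) = (\<Sum>j\<in>insert b S. w j i)" if "i \<in> insert a T" for i
  proof -
    have "(\<Sum>u\<in>V. w' (u, Inl i)) = (\<Sum>j\<in>insert b S. w' (Inr j, Inl i))"
      by (rule sum_V_Inr[OF ST_subset(1)]) (simp add: w'_0 del: image_insert)
    then show ?thesis using w'_eq[OF _ that] by simp
  qed
  have "(\<Sum>v\<in>V. w' (u, v)) \<le> unif_nbr E (Inl a) u" for u
  proof (cases "u \<in> Inr ` insert b S")
    case True
    then obtain j where "u = Inr j" "j \<in> insert b S" by blast
    then show ?thesis using row' row by (simp add: unif_nbr_eq image_iff)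
  next
    case False
    then show ?thesis by (simp add: w'_0 unif_nbr_eq del: image_insert)
  qed
  moreover have "(\<Sum>u\<in>V. w' (u, v)) \<le> unif_nbr E (Inr b) v" for v
  proof (cases "v \<in> Inl ` insert a T")
    case True
    then obtain i where "v = Inl i" "i \<in> insert a T" by blast
    then show ?thesis using col' col by (simp add: unif_nbr_eq image_iff)
  next
    case False
    then show ?thesis by (simp add: w'_0 unif_nbr_eq del: image_insert)
  qed
  moreover have "E u v" if "w' (u, v) \<noteq> 0" for u v
  proof -
    have "u \<in> Inr ` insert b S" "v \<in> Inl ` insert a T"
      using w'_0[of u v] that by argo+
    then obtain j i where ji: "u = Inr j" "j \<in> insert b S" "v = Inl i" "i \<in> insert a T"
      by blast
    then have "f (i, j)" using supp[of j i] w'_eq[of j i] that by metis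
    moreover have "i < n" "j < n" using ji ST_subset by blast+
    ultimately show ?thesis using ji by simp
  qed
  ultimately have "wasserstein1 V (\<lambda>u v. real (gdist E u v)) (unif_nbr E (Inl a)) (unif_nbr E (Inr b))
      \<le> 3 - 2 * (\<Sum>u\<in>V. \<Sum>v\<in>V. w' (u, v))"
    using w'_nonneg by (intro wasserstein1_le_of_subcoupling) auto
  moreover have "(\<Sum>u\<in>V. \<Sum>v\<in>V. w' (u, v)) = (\<Sum>j\<in>insert b S. \<Sum>v\<in>V. w' (Inr j, v))"
    by (rule sum_V_Inr[OF ST_subset(1)]) (simp add: w'_0 del: image_insert)
  ultimately show ?thesis using row' by (simp add: kappa_eq_wasserstein)
qed

lemma kappa_ge: "- 2 \<le> kappa n a b f"
  using kappa_ge_of_subcoupling[of "\<lambda>_ _. 0"] by simp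

text \<open>Without cross edges every adjacent pair contains \<open>a\<close> or \<open>b\<close>,
  and \<open>kappa_le\<close> bounds the curvature from above. The matching lower bound comes from
  explicit plans along the edges at \<open>a\<close> and \<open>b\<close>.\<close>

lemma kappa_no_cross_edges:
  assumes "cross_edges n a b f = 0"
  shows "kappa n a b f = - 2 * max (1 - 1 / (1 + real (card S)) - 1 / (1 + real (card T))) 0"
proof -
  let ?s = "real (card S)" and ?t = "real (card T)"
  have bT: "f (i, b)" if "i \<in> insert a T" for i
    using that edge by (auto simp: other_nbrs_right_def)
  have aS: "f (a, j)" if "j \<in> insert b S" for j
    using that edge by (auto simp: other_nbrs_left_def)
  have max_bound: "- 2 * max (1 - x - y) 0 \<le> k" if "- 2 + 2 * (x + y) \<le> k" for x y k :: real
    using that by (auto simp: max_def)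
  \<comment> \<open>If one endpoint has no other neighbour, one of the two measures is a point mass
    at the other endpoint. All mass then moves along edges, and the positive part is 0.\<close>
  consider "S = {}" | "T = {}" | "S \<noteq> {}" "T \<noteq> {}" by blast
  then have "kappa n a b f \<ge> - 2 * max (1 - 1 / (1 + ?s) - 1 / (1 + ?t)) 0"
  proof cases
    case 1
    have "kappa n a b f \<ge> - 2 + 2 * (\<Sum>j\<in>insert b S. \<Sum>i\<in>insert a T. 1 / (1 + ?t))"
      by (rule kappa_ge_of_subcoupling) (use 1 bT in \<open>auto simp: add_divide_distrib[symmetric]\<close>)
    with 1 show ?thesis by (simp add: add_divide_distrib[symmetric])
  next
    case 2
    have "kappa n a b f \<ge> - 2 + 2 * (\<Sum>j\<in>insert b S. \<Sum>i\<in>insert a T. 1 / (1 + ?s))"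
      by (rule kappa_ge_of_subcoupling) (use 2 aS in \<open>auto simp: add_divide_distrib[symmetric]\<close>)
    with 2 show ?thesis by (simp add: add_divide_distrib[symmetric])
  next
    case 3
    then have st: "?s \<ge> 1" "?t \<ge> 1" by (auto simp: Suc_le_eq card_gt_0_iff)
    \<comment> \<open>The mass at \<open>b\<close> is spread evenly over \<open>T\<close>, and the
      mass that \<open>a\<close> receives is taken evenly from \<open>S\<close>; the pair of
      \<open>b\<close> and \<open>a\<close> itself is left empty.\<close>
    define w where "w j i = (if j = b \<and> i \<noteq> a then 1 / ((1 + ?s) * ?t)
      else if j \<noteq> b \<and> i = a then 1 / ((1 + ?t) * ?s) else 0)" for j i
    have rb: "(\<Sum>i\<in>insert a T. w b i) = 1 / (1 + ?s)"
    proof -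
      have "(\<Sum>i\<in>T. w b i) = (\<Sum>i\<in>T. 1 / ((1 + ?s) * ?t))"
        by (intro sum.cong) (auto simp: w_def)
      moreover have "w b a = 0" by (simp add: w_def)
      ultimately show ?thesis using st 3 by simp
    qed
    have r: "(\<Sum>i\<in>insert a T. w j i) = 1 / ((1 + ?t) * ?s)" if "j \<in> S" for j
    proof -
      have "j \<noteq> b" using that by auto
      moreover have "(\<Sum>i\<in>T. w j i) = 0" using \<open>j \<noteq> b\<close> by (auto simp: w_def intro!: sum.neutral)
      ultimately show ?thesis by (simp add: w_def)
    qed
    have ca: "(\<Sum>j\<in>insert b S. w j a) = 1 / (1 + ?t)"
    proof -
      have "(\<Sum>j\<in>S. w j a) = (\<Sum>j\<in>S. 1 / ((1 + ?t) * ?s))"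
        by (intro sum.cong) (auto simp: w_def)
      moreover have "w b a = 0" by (simp add: w_def)
      ultimately show ?thesis using st 3 by simp
    qed
    have c: "(\<Sum>j\<in>insert b S. w j i) = 1 / ((1 + ?s) * ?t)" if "i \<in> T" for i
    proof -
      have "i \<noteq> a" using that by auto
      moreover have "(\<Sum>j\<in>S. w j i) = 0" using \<open>i \<noteq> a\<close> by (auto simp: w_def intro!: sum.neutral)
      ultimately show ?thesis by (simp add: w_def)
    qed
    \<comment> \<open>Rows in \<open>S\<close> and columns in \<open>T\<close> stay within their
      capacity because \<open>1 \<le> ?s * ?t\<close>; this is where both sets have to be
      nonempty.\<close>
    have le: "1 / ((1 + ?t) * ?s) \<le> 1 / (1 + ?s)" "1 / ((1 + ?s) * ?t) \<le> 1 / (1 + ?t)"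
    proof -
      have "1 \<le> ?s * ?t" using mult_mono[OF st] by simp
      then have "1 + ?s \<le> (1 + ?t) * ?s" "1 + ?t \<le> (1 + ?s) * ?t"
        by (simp_all add: algebra_simps)
      then show "1 / ((1 + ?t) * ?s) \<le> 1 / (1 + ?s)" "1 / ((1 + ?s) * ?t) \<le> 1 / (1 + ?t)"
        using st by (auto intro!: divide_left_mono)
    qed
    have "kappa n a b f \<ge> - 2 + 2 * (\<Sum>j\<in>insert b S. \<Sum>i\<in>insert a T. w j i)"
    proof (rule kappa_ge_of_subcoupling)
      show "0 \<le> w j i" for j i using st by (auto simp: w_def)
      show "(\<Sum>i\<in>insert a T. w j i) \<le> 1 / (1 + ?s)" if "j \<in> insert b S" for j
        using that rb r le by (cases "j = b") auto
      show "(\<Sum>j\<in>insert b S. w j i) \<le> 1 / (1 + ?t)" if "i \<in> insert a T" for i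
        using that ca c le by (cases "i = a") auto
      show "f (i, j)" if "j \<in> insert b S" "i \<in> insert a T" "w j i \<noteq> 0" for i j
        using that aS bT by (auto simp: w_def split: if_splits)
    qed
    also have "(\<Sum>j\<in>insert b S. \<Sum>i\<in>insert a T. w j i) = 1 / (1 + ?s) + (\<Sum>j\<in>S. 1 / ((1 + ?t) * ?s))"
      using rb r by (subst sum.insert) auto
    also have "\<dots> = 1 / (1 + ?s) + 1 / (1 + ?t)" using st 3 by simp
    finally show ?thesis by (rule max_bound)
  qed
  moreover have "kappa n a b f \<le> - 2 * (1 - 1 / (1 + ?s) - 1 / (1 + ?t))"
    using kappa_le assms by (simp add: algebra_simps)
  ultimately show ?thesis using kappa_nonpos by (auto simp: max_def)
qed

end

section \<open>Lower bound for the curvature from nearly regular cross edges\<close>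

lemma sum_abs_le_sum_squares:
  fixes z :: "'b \<Rightarrow> real"
  assumes "0 < \<eta>"
  shows "(\<Sum>j\<in>A. \<bar>z j\<bar>) \<le> (\<Sum>j\<in>A. (z j)\<^sup>2) / \<eta> + real (card A) * \<eta>"
proof -
  \<comment> \<open>Entries of size at most \<open>\<eta>\<close> are paid for by the second term,
    larger ones by the first.\<close>
  have "\<bar>x\<bar> \<le> x\<^sup>2 / \<eta> + \<eta>" for x :: real
  proof (cases "\<bar>x\<bar> \<le> \<eta>")
    case True
    then show ?thesis using assms by (simp add: add_increasing)
  next
    case False
    then have "\<bar>x\<bar> * \<eta> \<le> \<bar>x\<bar> * \<bar>x\<bar>" by (intro mult_left_mono) auto
    then have "\<bar>x\<bar> \<le> x\<^sup>2 / \<eta>" using assms by (simp add: field_simps power2_eq_square)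
    then show ?thesis using assms by simp
  qed
  then have "(\<Sum>j\<in>A. \<bar>z j\<bar>) \<le> (\<Sum>j\<in>A. (z j)\<^sup>2 / \<eta> + \<eta>)" by (intro sum_mono)
  then show ?thesis by (simp add: sum.distrib sum_divide_distrib)
qed

context bip_edge
begin

text \<open>The uniform weight on the cross edges is damped at every vertex whose degree exceeds the
  expected one, so that the result is a subcoupling; the damping costs at most the discrepancy of
  the degrees.\<close>

lemma kappa_ge_discrepancy:
  fixes q :: real
  assumes q: "0 < q"
  defines "s \<equiv> real (card S)" and "t \<equiv> real (card T)"
  defines "D \<equiv> \<lambda>j. \<Sum>i\<in>T. of_bool (f (i, j))" and "D' \<equiv> \<lambda>i. \<Sum>j\<in>S. of_bool (f (i, j))"
  shows "kappa n a b f \<ge> - 2 + 2 * ((q * s * t - (\<Sum>j\<in>S. \<bar>D j - q * t\<bar>) - (\<Sum>i\<in>T. \<bar>D' i - q * s\<bar>))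
                                    / (q * (1 + s) * (1 + t)))"
proof -
  have st: "0 \<le> s" "0 \<le> t" by (simp_all add: s_def t_def)
  have D0: "0 \<le> D j" "0 \<le> D' j" for j by (simp_all add: D_def D'_def sum_nonneg)
  \<comment> \<open>With this constant, a vertex of \<open>S\<close> with at most
    \<open>q * t\<close> cross edges sends at most \<open>t / ((1 + s) * (1 + t))\<close>, which is
    within its capacity; likewise for \<open>T\<close>.\<close>
  define c where "c = 1 / (q * (1 + s) * (1 + t))"
  have c0: "0 < c" using q st by (auto simp: c_def intro!: divide_pos_pos mult_pos_pos)
  \<comment> \<open>For \<open>D j = 0\<close> the division yields 0 and so does the factor; the
    identity for \<open>D j * \<alpha> j\<close> below still holds, as both sides are 0. The same
    applies to \<open>\<beta>\<close>.\<close>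
  define \<alpha> where "\<alpha> j = min 1 (q * t / D j)" for j
  define \<beta> where "\<beta> i = min 1 (q * s / D' i)" for i
  have \<alpha>: "0 \<le> \<alpha> j" "\<alpha> j \<le> 1" "D j * \<alpha> j = min (D j) (q * t)" for j
    using D0[of j] q st by (auto simp: \<alpha>_def min_def field_simps)
  have \<beta>: "0 \<le> \<beta> i" "\<beta> i \<le> 1" "D' i * \<beta> i = min (D' i) (q * s)" for i
    using D0[of i] q st by (auto simp: \<beta>_def min_def field_simps)
  define w where "w j i = (if j \<in> S \<and> i \<in> T then c * of_bool (f (i, j)) * \<alpha> j * \<beta> i else 0)" for j i
  have w0: "0 \<le> w j i" for j i using c0 \<alpha> \<beta> by (auto simp: w_def)
  have row_eq: "(\<Sum>i\<in>insert a T. w j i) = (\<Sum>i\<in>T. w j i)" for j by (simp add: w_def)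
  have col_eq: "(\<Sum>j\<in>insert b S. w j i) = (\<Sum>j\<in>S. w j i)" for i by (simp add: w_def)
  have row: "(\<Sum>i\<in>insert a T. w j i) \<le> 1 / (1 + s)" for j
  proof (cases "j \<in> S")
    case True
    have "(\<Sum>i\<in>T. w j i) \<le> (\<Sum>i\<in>T. c * \<alpha> j * of_bool (f (i, j)))"
    proof (rule sum_mono)
      fix i assume "i \<in> T"
      \<comment> \<open>Row sums need only the damping \<open>\<alpha>\<close>, column sums only
        \<open>\<beta>\<close>; the other factor is bounded by 1.\<close>
      have "c * of_bool (f (i, j)) * \<alpha> j * \<beta> i \<le> c * of_bool (f (i, j)) * \<alpha> j * 1"
        using c0 \<alpha> \<beta> by (intro mult_left_mono) auto
      then show "w j i \<le> c * \<alpha> j * of_bool (f (i, j))"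
        using True \<open>i \<in> T\<close> by (simp add: w_def mult_ac)
    qed
    also have "\<dots> = c * (D j * \<alpha> j)" by (simp only: D_def sum_distrib_left mult_ac)
    also have "\<dots> \<le> c * (q * t)" using c0 \<alpha>(3) by (intro mult_left_mono) auto
    also have "\<dots> = t / ((1 + s) * (1 + t))" using q by (simp add: c_def)
    also have "\<dots> \<le> 1 / (1 + s)" using st by (simp add: field_simps add_pos_nonneg)
    finally show ?thesis using row_eq by simp
  next
    case False
    then show ?thesis using st by (simp add: w_def)
  qed
  have col: "(\<Sum>j\<in>insert b S. w j i) \<le> 1 / (1 + t)" for i
  proof (cases "i \<in> T")
    case True
    have "(\<Sum>j\<in>S. w j i) \<le> (\<Sum>j\<in>S. c * \<beta> i * of_bool (f (i, j)))"
    proof (rule sum_mono)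
      fix j assume "j \<in> S"
      have "c * of_bool (f (i, j)) * \<beta> i * \<alpha> j \<le> c * of_bool (f (i, j)) * \<beta> i * 1"
        using c0 \<alpha> \<beta> by (intro mult_left_mono) auto
      then show "w j i \<le> c * \<beta> i * of_bool (f (i, j))"
        using True \<open>j \<in> S\<close> by (simp add: w_def mult_ac)
    qed
    also have "\<dots> = c * (D' i * \<beta> i)" by (simp only: D'_def sum_distrib_left mult_ac)
    also have "\<dots> \<le> c * (q * s)" using c0 \<beta>(3) by (intro mult_left_mono) auto
    also have "\<dots> = s / ((1 + s) * (1 + t))" using q by (simp add: c_def)
    also have "\<dots> \<le> 1 / (1 + t)" using st by (simp add: field_simps add_pos_nonneg)
    finally show ?thesis using col_eq by simp
  next
    case False
    then show ?thesis using st by (simp add: w_def)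
  qed
  have "kappa n a b f \<ge> - 2 + 2 * (\<Sum>j\<in>insert b S. \<Sum>i\<in>insert a T. w j i)"
    using w0 row col unfolding s_def t_def
    by (rule kappa_ge_of_subcoupling) (auto simp: w_def split: if_splits)
  also have "(\<Sum>j\<in>insert b S. \<Sum>i\<in>insert a T. w j i) = (\<Sum>j\<in>S. \<Sum>i\<in>T. w j i)"
    unfolding row_eq by (simp add: w_def)
  finally have \<kappa>: "kappa n a b f \<ge> - 2 + 2 * (\<Sum>j\<in>S. \<Sum>i\<in>T. w j i)" .
  \<comment> \<open>From \<open>(1 - \<alpha> j) * (1 - \<beta> i) \<ge> 0\<close> it follows that
    the product of the dampings is at least \<open>\<alpha> j - (1 - \<beta> i)\<close>. The two
    losses thus separate into a sum over rows and a sum over columns.\<close>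
  have "c * ((\<Sum>j\<in>S. D j * \<alpha> j) - (\<Sum>i\<in>T. D' i - D' i * \<beta> i)) =
      c * ((\<Sum>j\<in>S. \<Sum>i\<in>T. of_bool (f (i, j)) * \<alpha> j) - (\<Sum>i\<in>T. \<Sum>j\<in>S. of_bool (f (i, j)) * (1 - \<beta> i)))"
    by (simp only: D_def D'_def sum_distrib_right right_diff_distrib mult_1_right sum_subtractf)
  also have "(\<Sum>i\<in>T. \<Sum>j\<in>S. of_bool (f (i, j)) * (1 - \<beta> i)) = (\<Sum>j\<in>S. \<Sum>i\<in>T. of_bool (f (i, j)) * (1 - \<beta> i))"
    by (rule sum.swap)
  also have "c * ((\<Sum>j\<in>S. \<Sum>i\<in>T. of_bool (f (i, j)) * \<alpha> j) - \<dots>)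
      = (\<Sum>j\<in>S. \<Sum>i\<in>T. c * (of_bool (f (i, j)) * \<alpha> j - of_bool (f (i, j)) * (1 - \<beta> i)))"
    by (simp only: sum_subtractf sum_distrib_left right_diff_distrib)
  also have "\<dots> \<le> (\<Sum>j\<in>S. \<Sum>i\<in>T. w j i)"
  proof (intro sum_mono)
    fix j i assume ji: "j \<in> S" "i \<in> T"
    have "0 \<le> (1 - \<alpha> j) * (1 - \<beta> i)" using \<alpha> \<beta> by simp
    then have "\<alpha> j - (1 - \<beta> i) \<le> \<alpha> j * \<beta> i" by (simp add: algebra_simps)
    then show "c * (of_bool (f (i, j)) * \<alpha> j - of_bool (f (i, j)) * (1 - \<beta> i)) \<le> w j i"
      using c0 ji by (auto simp: w_def)
  qed
  finally have M: "c * ((\<Sum>j\<in>S. D j * \<alpha> j) - (\<Sum>i\<in>T. D' i - D' i * \<beta> i)) \<le> (\<Sum>j\<in>S. \<Sum>i\<in>T. w j i)" .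
  have "(\<Sum>j\<in>S. q * t - \<bar>D j - q * t\<bar>) \<le> (\<Sum>j\<in>S. D j * \<alpha> j)"
    unfolding \<alpha>(3) by (rule sum_mono) (auto simp: min_def)
  moreover have "(\<Sum>j\<in>S. q * t - \<bar>D j - q * t\<bar>) = q * s * t - (\<Sum>j\<in>S. \<bar>D j - q * t\<bar>)"
    by (simp add: sum_subtractf s_def)
  moreover have "(\<Sum>i\<in>T. D' i - D' i * \<beta> i) \<le> (\<Sum>i\<in>T. \<bar>D' i - q * s\<bar>)"
    unfolding \<beta>(3) by (rule sum_mono) (auto simp: min_def)
  ultimately have "c * (q * s * t - (\<Sum>j\<in>S. \<bar>D j - q * t\<bar>) - (\<Sum>i\<in>T. \<bar>D' i - q * s\<bar>))
      \<le> c * ((\<Sum>j\<in>S. D j * \<alpha> j) - (\<Sum>i\<in>T. D' i - D' i * \<beta> i))"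
    using c0 by (intro mult_left_mono) auto
  then have "c * (q * s * t - (\<Sum>j\<in>S. \<bar>D j - q * t\<bar>) - (\<Sum>i\<in>T. \<bar>D' i - q * s\<bar>))
      \<le> (\<Sum>j\<in>S. \<Sum>i\<in>T. w j i)"
    using M by (rule order_trans)
  then have "(q * s * t - (\<Sum>j\<in>S. \<bar>D j - q * t\<bar>) - (\<Sum>i\<in>T. \<bar>D' i - q * s\<bar>))
      / (q * (1 + s) * (1 + t)) \<le> (\<Sum>j\<in>S. \<Sum>i\<in>T. w j i)"
    by (simp add: c_def)
  with \<kappa> show ?thesis by linarith
qed

text \<open>Each absolute discrepancy is turned into a sum of squares, with threshold a fraction
  \<open>\<delta>\<close> of the expected degree. After normalisation each side loses
  \<open>Q / (\<delta> * q\<^sup>2 * m ^ 3) + \<delta>\<close>, and replacing \<open>1 + s\<close>,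
  \<open>1 + t\<close> by \<open>s\<close>, \<open>t\<close> costs at most
  \<open>2 / m\<close>.\<close>

lemma kappa_ge_second_moment:
  fixes q \<delta> m Q :: real
  assumes q: "0 < q" and \<delta>: "0 < \<delta>" and m: "0 < m" "m \<le> real (card S)" "m \<le> real (card T)"
    and Q: "(\<Sum>j\<in>S. ((\<Sum>i\<in>T. of_bool (f (i, j))) - q * real (card T))\<^sup>2) \<le> Q"
    and Q': "(\<Sum>i\<in>T. ((\<Sum>j\<in>S. of_bool (f (i, j))) - q * real (card S))\<^sup>2) \<le> Q"
  shows "kappa n a b f \<ge> - 4 * (1 / m + Q / (\<delta> * q\<^sup>2 * m ^ 3) + \<delta>)"
proof -
  define s where "s = real (card S)"
  define t where "t = real (card T)"
  have st: "0 < s" "0 < t" "m \<le> s" "m \<le> t" using m by (auto simp: s_def t_def)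
  define z where "z = (\<Sum>j\<in>S. \<bar>(\<Sum>i\<in>T. of_bool (f (i, j))) - q * t\<bar>)"
  define z' where "z' = (\<Sum>i\<in>T. \<bar>(\<Sum>j\<in>S. of_bool (f (i, j))) - q * s\<bar>)"
  define P where "P = q * (1 + s) * (1 + t)"
  have P0: "0 < P" using q st by (simp add: P_def)
  have Q0: "0 \<le> Q" using Q by (rule order_trans[rotated]) (simp add: sum_nonneg)
  \<comment> \<open>One estimate for both sides: \<open>x\<close> is the number of vertices summed
    over, \<open>y\<close> the size of the set in which their degrees are counted.\<close>
  have main: "u / P \<le> Q / (\<delta> * q\<^sup>2 * m ^ 3) + \<delta>"
    if u: "u \<le> Q / (\<delta> * q * y) + x * (\<delta> * q * y)" and xy: "x = s \<and> y = t \<or> x = t \<and> y = s"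
    for u x y :: real
  proof -
    have xy0: "0 < x" "0 < y" "m \<le> x" "m \<le> y" using xy st by auto
    have Pxy: "q * x * y \<le> P" using xy q st by (auto simp: P_def algebra_simps)
    have "u / P \<le> (Q / (\<delta> * q * y) + x * (\<delta> * q * y)) / P"
      using u P0 by (simp add: divide_right_mono)
    also have "\<dots> \<le> (Q / (\<delta> * q * y) + x * (\<delta> * q * y)) / (q * x * y)"
      using Pxy P0 Q0 \<delta> q xy0 by (intro divide_left_mono) auto
    also have "\<dots> = Q / (\<delta> * q\<^sup>2 * (x * y * y)) + \<delta>"
      using q xy0 by (simp add: field_simps power2_eq_square)
    also have "Q / (\<delta> * q\<^sup>2 * (x * y * y)) \<le> Q / (\<delta> * q\<^sup>2 * m ^ 3)"
    proof -
      have "m * m * m \<le> x * y * y" using xy0 m by (intro mult_mono) auto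
      then have "\<delta> * q\<^sup>2 * m ^ 3 \<le> \<delta> * q\<^sup>2 * (x * y * y)"
        using \<delta> by (intro mult_left_mono) (auto simp: power3_eq_cube)
      then show ?thesis using Q0 \<delta> q m xy0 by (intro divide_left_mono) auto
    qed
    finally show ?thesis by simp
  qed
  have "z \<le> (\<Sum>j\<in>S. ((\<Sum>i\<in>T. of_bool (f (i, j))) - q * t)\<^sup>2) / (\<delta> * q * t) + s * (\<delta> * q * t)"
    unfolding z_def s_def by (rule sum_abs_le_sum_squares) (use \<delta> q st in auto)
  also have "(\<Sum>j\<in>S. ((\<Sum>i\<in>T. of_bool (f (i, j))) - q * t)\<^sup>2) / (\<delta> * q * t) \<le> Q / (\<delta> * q * t)"
    using Q \<delta> q st unfolding t_def[symmetric] by (intro divide_right_mono) auto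
  finally have z: "z / P \<le> Q / (\<delta> * q\<^sup>2 * m ^ 3) + \<delta>" by (intro main[of z t s]) auto
  have "z' \<le> (\<Sum>i\<in>T. ((\<Sum>j\<in>S. of_bool (f (i, j))) - q * s)\<^sup>2) / (\<delta> * q * s) + t * (\<delta> * q * s)"
    unfolding z'_def t_def by (rule sum_abs_le_sum_squares) (use \<delta> q st in auto)
  also have "(\<Sum>i\<in>T. ((\<Sum>j\<in>S. of_bool (f (i, j))) - q * s)\<^sup>2) / (\<delta> * q * s) \<le> Q / (\<delta> * q * s)"
    using Q' \<delta> q st unfolding s_def[symmetric] by (intro divide_right_mono) auto
  finally have z': "z' / P \<le> Q / (\<delta> * q\<^sup>2 * m ^ 3) + \<delta>" by (intro main[of z' s t]) auto
  have "1 - 1 / (1 + s) - 1 / (1 + t) \<le> q * s * t / P"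
    unfolding P_def using q st by (simp add: field_simps add_pos_pos)
  moreover have "1 / (1 + s) \<le> 1 / m" "1 / (1 + t) \<le> 1 / m"
    using st m by (auto intro!: divide_left_mono)
  moreover have "(q * s * t - z - z') / P = q * s * t / P - z / P - z' / P"
    by (simp add: diff_divide_distrib)
  moreover have "kappa n a b f \<ge> - 2 + 2 * ((q * s * t - z - z') / P)"
    using kappa_ge_discrepancy[OF q] unfolding z_def z'_def P_def s_def t_def .
  ultimately show ?thesis using z z' by argo
qed

end

section \<open>Moments of the conditioned random graph\<close>

text \<open>Events are compared on the support only, where the edge (a, b) is present and the bounds
  for a fixed graph apply.\<close>

lemma prob_mono_supp:
  assumes "\<And>x. x \<in> set_pmf M \<Longrightarrow> x \<in> A \<Longrightarrow> x \<in> B"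
  shows "measure_pmf.prob M A \<le> measure_pmf.prob M B"
proof -
  have "measure_pmf.prob M A = measure_pmf.prob M (A \<inter> set_pmf M)"
    by (simp add: measure_Int_set_pmf)
  also have "\<dots> \<le> measure_pmf.prob M B"
    by (rule measure_pmf.finite_measure_mono) (use assms in auto)
  finally show ?thesis .
qed

text \<open>The monomial in the edge indicators indexed by \<open>A\<close>; for the empty set it is
  1. Random index sets and moments are expanded in these monomials.\<close>

definition all_on :: "'a set \<Rightarrow> ('a \<Rightarrow> bool) \<Rightarrow> real" where
  "all_on A f = of_bool (\<forall>z\<in>A. f z)"

text \<open>Conditioning fixes a single coordinate: its factor \<open>p\<close> in the product
  cancels against the probability \<open>p\<close> of the event, and the other coordinates keep
  their law. So the conditioned graph is again a product.\<close>

lemma bip_graph_cond_pmf_eq_Pi_pmf: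
  assumes "a < n" "b < n" "0 < p" "p \<le> 1"
  shows "bip_graph_cond_pmf n p a b =
    Pi_pmf ({..<n} \<times> {..<n}) False (\<lambda>z. bernoulli_pmf (if z = (a, b) then 1 else p))"
    (is "_ = Pi_pmf ?I False ?q")
proof (rule pmf_eqI)
  fix f
  have fin: "finite ?I" and ab: "(a, b) \<in> ?I" using assms by auto
  let ?P = "Pi_pmf ?I False (\<lambda>_. bernoulli_pmf p)"
  have "measure_pmf.prob ?P {f. f (a, b)} = measure_pmf.prob (map_pmf (\<lambda>f. f (a, b)) ?P) {True}"
    by (simp add: vimage_def)
  also have "\<dots> = p" using assms ab by (simp add: Pi_pmf_component measure_pmf_single)
  finally have p: "measure_pmf.prob ?P {f. f (a, b)} = p" .
  then have ne: "set_pmf ?P \<inter> {f. f (a, b)} \<noteq> {}"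
    using assms by (auto simp: measure_pmf_zero_iff[symmetric])
  have rest: "(\<Prod>z\<in>?I - {(a, b)}. pmf (?q z) (f z)) = (\<Prod>z\<in>?I - {(a, b)}. pmf (bernoulli_pmf p) (f z))"
    by (rule prod.cong) auto
  have "pmf (bip_graph_cond_pmf n p a b) f = (if f (a, b) then pmf ?P f / p else 0)"
    unfolding bip_graph_cond_pmf_def bip_graph_pmf_def using pmf_cond[OF ne] p by simp
  also have "\<dots> = pmf (Pi_pmf ?I False ?q) f"
    using assms unfolding pmf_Pi[OF fin] prod.remove[OF fin ab] rest by (cases "f (a, b)") auto
  finally show "pmf (bip_graph_cond_pmf n p a b) f = pmf (Pi_pmf ?I False ?q) f" .
qed

locale bip_model =
  fixes n a b :: nat and p :: real
  assumes a_less: "a < n" and b_less: "b < n" and p_pos: "0 < p" and p_le_1: "p \<le> 1"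
begin

abbreviation "G \<equiv> bip_graph_cond_pmf n p a b"
abbreviation "I \<equiv> {..<n} \<times> {..<n} - {(a, b)}"

lemmas G_eq = bip_graph_cond_pmf_eq_Pi_pmf[OF a_less b_less p_pos p_le_1]

lemma finite_set_G: "finite (set_pmf G)"
  unfolding G_eq by (rule finite_subset[OF set_Pi_pmf_subset']) (auto intro!: finite_PiE_dflt)

lemma integrable_G [simp]: "integrable (measure_pmf G) (g :: _ \<Rightarrow> real)"
  by (rule integrable_measure_pmf_finite[OF finite_set_G])

lemma bip_edge_supp: "f \<in> set_pmf G \<Longrightarrow> bip_edge n a b f"
proof -
  assume "f \<in> set_pmf G"
  then have "f (a, b) \<in> set_pmf (map_pmf (\<lambda>f. f (a, b)) G)" by auto
  then have "f (a, b)"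
    unfolding G_eq using a_less b_less
    by (cases "f (a, b)") (simp_all add: Pi_pmf_component set_pmf_iff)
  then show ?thesis using a_less b_less by unfold_locales
qed

text \<open>The event is a box in the product space, so its probability factorises over the
  coordinates in \<open>A\<close>, none of which is the forced one.\<close>

lemma expectation_all_on:
  assumes "A \<subseteq> I"
  shows "measure_pmf.expectation G (all_on A) = p ^ card A"
proof -
  have A: "A \<subseteq> {..<n} \<times> {..<n}" "(a, b) \<notin> A" using assms by auto
  have "all_on A = indicator {f. \<forall>z\<in>A. f z}"
    by (auto simp: all_on_def fun_eq_iff split: split_indicator)
  then have "measure_pmf.expectation G (all_on A) = measure_pmf.prob G {f. \<forall>z\<in>A. f z}"
    by simp
  also have "{f. \<forall>z\<in>A. f z} = Pi ({..<n} \<times> {..<n}) (\<lambda>z. if z \<in> A then {True} else UNIV)"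
    using A by (auto simp: Pi_def split: if_splits)
  also have "measure_pmf.prob G \<dots> = (\<Prod>z\<in>{..<n} \<times> {..<n}. if z \<in> A then p else 1)"
    unfolding G_eq measure_Pi_pmf_Pi[OF finite_cartesian_product[OF finite_lessThan finite_lessThan]]
    using A p_pos p_le_1 by (intro prod.cong) (auto simp: measure_pmf_single)
  also have "\<dots> = (\<Prod>z\<in>A. p)"
    by (rule prod.mono_neutral_cong_right) (use A in auto)
  finally show ?thesis by simp
qed

text \<open>Independence of the coordinate \<open>z\<close> from \<open>A\<close>, reduced to
  monomials: multiplying by the indicator at \<open>z\<close> just inserts \<open>z\<close> into
  \<open>A\<close>.\<close>

lemma expectation_all_on_centered:
  assumes "A \<subseteq> I" "z \<in> I" "z \<notin> A"
  shows "measure_pmf.expectation G (\<lambda>f. all_on A f * (of_bool (f z) - p)) = 0"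
proof -
  have "(\<lambda>f. all_on A f * (of_bool (f z) - p)) = (\<lambda>f. all_on (insert z A) f - p * all_on A f)"
    by (auto simp: all_on_def fun_eq_iff)
  moreover have "card (insert z A) = Suc (card A)"
    using assms finite_subset[of A I] by simp
  ultimately show ?thesis
    using assms by (simp add: expectation_all_on)
qed

text \<open>The summands are uncorrelated: \<open>z i\<close> is independent of all other coordinates that occur
  in the product of two of them.\<close>

lemma expectation_sum_square:
  assumes fin: "finite C" and A: "\<And>i. i \<in> C \<Longrightarrow> A i \<subseteq> I" and z: "\<And>i. i \<in> C \<Longrightarrow> z i \<in> I"
    and zA: "\<And>i k. i \<in> C \<Longrightarrow> k \<in> C \<Longrightarrow> z i \<notin> A k" and inj: "inj_on z C"
    and c: "\<And>i. i \<in> C \<Longrightarrow> card (A i) = c"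
  shows "measure_pmf.expectation G (\<lambda>f. (\<Sum>i\<in>C. all_on (A i) f * (of_bool (f (z i)) - p))\<^sup>2)
           \<le> real (card C) * p ^ Suc c"
proof -
  let ?Y = "\<lambda>i f. all_on (A i) f * (of_bool (f (z i)) - p)"
  have cross: "measure_pmf.expectation G (\<lambda>f. ?Y i f * ?Y k f) = 0"
    if ik: "i \<in> C" "k \<in> C" "i \<noteq> k" for i k
  proof -
    have zk: "z i \<noteq> z k" using inj ik by (auto dest: inj_onD)
    let ?B = "A i \<union> A k"
    \<comment> \<open>The factor at \<open>z k\<close> is multiplied out and absorbed into the
      monomials; each remaining term has a centred factor at \<open>z i\<close> only.\<close>
    have "(\<lambda>f. ?Y i f * ?Y k f) = (\<lambda>f. all_on (insert (z k) ?B) f * (of_bool (f (z i)) - p)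
         - p * (all_on ?B f * (of_bool (f (z i)) - p)))"
      by (auto simp: all_on_def fun_eq_iff algebra_simps)
    moreover have "measure_pmf.expectation G (\<lambda>f. all_on (insert (z k) ?B) f * (of_bool (f (z i)) - p)) = 0"
      by (rule expectation_all_on_centered) (use A z zA ik zk in auto)
    moreover have "measure_pmf.expectation G (\<lambda>f. all_on ?B f * (of_bool (f (z i)) - p)) = 0"
      by (rule expectation_all_on_centered) (use A z zA ik zk in auto)
    ultimately show ?thesis by simp
  qed
  have diag: "measure_pmf.expectation G (\<lambda>f. ?Y i f * ?Y i f) \<le> p ^ Suc c" if i: "i \<in> C" for i
  proof -
    \<comment> \<open>For an indicator x, (x - p)^2 = (1 - p) x - p (x - p), and the last term has
      mean zero.\<close>
    have "(\<lambda>f. ?Y i f * ?Y i f) = (\<lambda>f. (1 - p) * all_on (insert (z i) (A i)) f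
         - p * (all_on (A i) f * (of_bool (f (z i)) - p)))"
      by (auto simp: all_on_def fun_eq_iff algebra_simps)
    moreover have "measure_pmf.expectation G (\<lambda>f. all_on (A i) f * (of_bool (f (z i)) - p)) = 0"
      by (rule expectation_all_on_centered) (use A z zA i in auto)
    moreover have "card (insert (z i) (A i)) = Suc c"
      using i A zA c finite_subset[of "A i" I] by auto
    moreover have "insert (z i) (A i) \<subseteq> I" using A z i by auto
    ultimately have "measure_pmf.expectation G (\<lambda>f. ?Y i f * ?Y i f) = (1 - p) * p ^ Suc c"
      by (simp add: expectation_all_on)
    also have "\<dots> \<le> 1 * p ^ Suc c" using p_pos by (intro mult_right_mono) auto
    finally show ?thesis by simp
  qed
  have "measure_pmf.expectation G (\<lambda>f. (\<Sum>i\<in>C. ?Y i f)\<^sup>2)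
      = (\<Sum>i\<in>C. \<Sum>k\<in>C. measure_pmf.expectation G (\<lambda>f. ?Y i f * ?Y k f))"
    unfolding power2_eq_square sum_product by (simp add: Bochner_Integration.integral_sum)
  also have "\<dots> = (\<Sum>i\<in>C. measure_pmf.expectation G (\<lambda>f. ?Y i f * ?Y i f))"
  proof (rule sum.cong[OF refl])
    fix i assume i: "i \<in> C"
    show "(\<Sum>k\<in>C. measure_pmf.expectation G (\<lambda>f. ?Y i f * ?Y k f))
        = measure_pmf.expectation G (\<lambda>f. ?Y i f * ?Y i f)"
      using sum.mono_neutral_right[of C "{i}" "\<lambda>k. measure_pmf.expectation G (\<lambda>f. ?Y i f * ?Y k f)"]
        fin i cross[OF i] by force
  qed
  also have "\<dots> \<le> (\<Sum>i\<in>C. p ^ Suc c)" by (intro sum_mono diag)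
  finally show ?thesis by simp
qed

lemma markov_G:
  assumes "\<And>f. 0 \<le> g f" "0 < c" "measure_pmf.expectation G g \<le> e"
  shows "measure_pmf.prob G {f. c \<le> g f} \<le> e / c"
proof -
  have "measure_pmf.prob G {f. c \<le> g f} \<le> measure_pmf.expectation G g / c"
    using integral_Markov_inequality_measure[of "measure_pmf G" g "{}" c] assms by simp
  also have "\<dots> \<le> e / c" using assms by (simp add: divide_right_mono)
  finally show ?thesis .
qed

section \<open>Degrees, cross edges and degree discrepancies\<close>

lemma card_other_nbrs:
  "real (card (other_nbrs_left n a b f)) = (\<Sum>j\<in>{..<n} - {b}. all_on {(a, j)} f)"
  "real (card (other_nbrs_right n a b f)) = (\<Sum>i\<in>{..<n} - {a}. all_on {(i, b)} f)"
  by (simp_all add: other_nbrs_left_def other_nbrs_right_def all_on_def Int_def)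

lemma expectation_card_other_nbrs:
  "measure_pmf.expectation G (\<lambda>f. real (card (other_nbrs_left n a b f))) \<le> real n * p"
  "measure_pmf.expectation G (\<lambda>f. real (card (other_nbrs_right n a b f))) \<le> real n * p"
proof -
  have "measure_pmf.expectation G (\<lambda>f. real (card (other_nbrs_left n a b f))) = (\<Sum>j\<in>{..<n} - {b}. p)"
    unfolding card_other_nbrs using a_less
    by (subst Bochner_Integration.integral_sum) (auto simp: expectation_all_on intro!: sum.cong)
  moreover have "measure_pmf.expectation G (\<lambda>f. real (card (other_nbrs_right n a b f))) = (\<Sum>i\<in>{..<n} - {a}. p)"
    unfolding card_other_nbrs using b_less
    by (subst Bochner_Integration.integral_sum) (auto simp: expectation_all_on intro!: sum.cong)
  ultimately show
    "measure_pmf.expectation G (\<lambda>f. real (card (other_nbrs_left n a b f))) \<le> real n * p"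
    "measure_pmf.expectation G (\<lambda>f. real (card (other_nbrs_right n a b f))) \<le> real n * p"
    using p_pos a_less b_less by (auto simp: card_Diff_singleton mult_right_mono)
qed

text \<open>Chebyshev: the mean \<open>(n - 1) * p\<close> is at least \<open>n * p / 2\<close>, so
  such a shortfall is a deviation of at least \<open>n * p / 4\<close>, while the variance is at
  most \<open>n * p\<close>.\<close>

lemma prob_few_other_nbrs:
  assumes n: "2 \<le> n"
  shows "measure_pmf.prob G {f. real (card (other_nbrs_left n a b f)) < real n * p / 4} \<le> 16 / (real n * p)"
    and "measure_pmf.prob G {f. real (card (other_nbrs_right n a b f)) < real n * p / 4} \<le> 16 / (real n * p)"
proof -
  have np: "0 < real n * p" using n p_pos by simp
  have main: "measure_pmf.prob G {f. h f < real n * p / 4} \<le> 16 / (real n * p)"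
    if E: "measure_pmf.expectation G (\<lambda>f. (h f - real (n - 1) * p)\<^sup>2) \<le> real n * p" for h
  proof -
    have "measure_pmf.prob G {f. h f < real n * p / 4}
        \<le> measure_pmf.prob G {f. (real n * p / 4)\<^sup>2 \<le> (h f - real (n - 1) * p)\<^sup>2}"
    proof (rule prob_mono_supp, safe)
      fix f assume "h f < real n * p / 4"
      moreover have "real n / 2 * p \<le> real (n - 1) * p"
        using n p_pos by (intro mult_right_mono) auto
      ultimately have "real n * p / 4 \<le> \<bar>h f - real (n - 1) * p\<bar>" by argo
      then show "(real n * p / 4)\<^sup>2 \<le> (h f - real (n - 1) * p)\<^sup>2"
        using np power_mono[of "real n * p / 4" "\<bar>h f - real (n - 1) * p\<bar>" 2] by simp
    qed
    also have "\<dots> \<le> (real n * p) / (real n * p / 4)\<^sup>2"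
      by (rule markov_G) (use n p_pos E in auto)
    also have "\<dots> = 16 / (real n * p)"
      using np by (simp add: power2_eq_square field_simps)
    finally show ?thesis .
  qed
  have le: "real (n - Suc 0) * p \<le> real n * p" using p_pos by (intro mult_right_mono) auto
  have "measure_pmf.expectation G (\<lambda>f. (\<Sum>j\<in>{..<n} - {b}. all_on {} f * (of_bool (f (a, j)) - p))\<^sup>2)
      \<le> real (card ({..<n} - {b})) * p ^ Suc 0"
    by (rule expectation_sum_square) (use a_less in \<open>auto intro!: inj_onI\<close>)
  moreover have "(\<Sum>j\<in>{..<n} - {b}. all_on {} f * (of_bool (f (a, j)) - p))
      = real (card (other_nbrs_left n a b f)) - real (n - 1) * p" for f
    using b_less unfolding card_other_nbrs by (simp add: all_on_def sum_subtractf card_Diff_singleton)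
  ultimately have "measure_pmf.expectation G (\<lambda>f. (real (card (other_nbrs_left n a b f)) - real (n - 1) * p)\<^sup>2)
      \<le> real n * p"
    using b_less le by (simp add: card_Diff_singleton)
  then show "measure_pmf.prob G {f. real (card (other_nbrs_left n a b f)) < real n * p / 4} \<le> 16 / (real n * p)"
    by (rule main)
  have "measure_pmf.expectation G (\<lambda>f. (\<Sum>i\<in>{..<n} - {a}. all_on {} f * (of_bool (f (i, b)) - p))\<^sup>2)
      \<le> real (card ({..<n} - {a})) * p ^ Suc 0"
    by (rule expectation_sum_square) (use b_less in \<open>auto intro!: inj_onI\<close>)
  moreover have "(\<Sum>i\<in>{..<n} - {a}. all_on {} f * (of_bool (f (i, b)) - p))
      = real (card (other_nbrs_right n a b f)) - real (n - 1) * p" for f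
    using a_less unfolding card_other_nbrs by (simp add: all_on_def sum_subtractf card_Diff_singleton)
  ultimately have "measure_pmf.expectation G (\<lambda>f. (real (card (other_nbrs_right n a b f)) - real (n - 1) * p)\<^sup>2)
      \<le> real n * p"
    using a_less le by (simp add: card_Diff_singleton)
  then show "measure_pmf.prob G {f. real (card (other_nbrs_right n a b f)) < real n * p / 4} \<le> 16 / (real n * p)"
    by (rule main)
qed

text \<open>A cross edge needs the three distinct edges (a, j), (i, b), (i, j), none of which is the
  conditioned one. Putting membership in the neighbourhoods into the monomial makes the index sets
  deterministic.\<close>

lemma expectation_cross_edges:
  "measure_pmf.expectation G (cross_edges n a b) \<le> (real n)\<^sup>2 * p ^ 3"
proof -
  let ?J = "{..<n} - {b}" and ?K = "{..<n} - {a}"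
  have "cross_edges n a b = (\<lambda>f. \<Sum>j\<in>?J. \<Sum>i\<in>?K. all_on {(a, j), (i, b), (i, j)} f)"
  proof
    fix f
    have "cross_edges n a b f = (\<Sum>j\<in>other_nbrs_left n a b f. \<Sum>i\<in>?K. all_on {(a, j), (i, b), (i, j)} f)"
      unfolding cross_edges_def
      by (intro sum.cong refl sum.mono_neutral_cong_left)
         (auto simp: other_nbrs_left_def other_nbrs_right_def all_on_def)
    also have "\<dots> = (\<Sum>j\<in>?J. \<Sum>i\<in>?K. all_on {(a, j), (i, b), (i, j)} f)"
      by (intro sum.mono_neutral_left) (auto simp: other_nbrs_left_def all_on_def)
    finally show "cross_edges n a b f = \<dots>" .
  qed
  then have "measure_pmf.expectation G (cross_edges n a b)
      = (\<Sum>j\<in>?J. \<Sum>i\<in>?K. measure_pmf.expectation G (all_on {(a, j), (i, b), (i, j)}))"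
    by (simp add: Bochner_Integration.integral_sum)
  also have "\<dots> = (\<Sum>j\<in>?J. \<Sum>i\<in>?K. p ^ 3)"
  proof (intro sum.cong refl)
    fix j i assume "j \<in> ?J" "i \<in> ?K"
    then have "{(a, j), (i, b), (i, j)} \<subseteq> I" "card {(a, j), (i, b), (i, j)} = 3"
      using a_less b_less by (auto simp: card_insert_if)
    then show "measure_pmf.expectation G (all_on {(a, j), (i, b), (i, j)}) = p ^ 3"
      by (metis expectation_all_on)
  qed
  also have "\<dots> = real (n - 1) * (real (n - 1) * p ^ 3)"
    using a_less b_less by (simp add: card_Diff_singleton)
  also have "\<dots> \<le> real n * (real n * p ^ 3)"
    using p_pos by (intro mult_mono) auto
  finally show ?thesis by (simp add: power2_eq_square mult.assoc)
qed

text \<open>For fixed \<open>j\<close> the discrepancy is a sum over \<open>i\<close> of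
  uncorrelated terms, each a centred indicator times the monomial of (a, j) and (i, b). So
  \<open>expectation_sum_square\<close> with \<open>c = 2\<close> gives
  \<open>(n - 1) * p ^ 3\<close> per vertex.\<close>

lemma expectation_discrepancy:
  defines "S \<equiv> other_nbrs_left n a b" and "T \<equiv> other_nbrs_right n a b"
  shows "measure_pmf.expectation G (\<lambda>f. \<Sum>j\<in>S f. ((\<Sum>i\<in>T f. of_bool (f (i, j))) - p * real (card (T f)))\<^sup>2)
           \<le> (real n)\<^sup>2 * p ^ 3"
    and "measure_pmf.expectation G (\<lambda>f. \<Sum>i\<in>T f. ((\<Sum>j\<in>S f. of_bool (f (i, j))) - p * real (card (S f)))\<^sup>2)
           \<le> (real n)\<^sup>2 * p ^ 3"
proof -
  let ?J = "{..<n} - {b}" and ?K = "{..<n} - {a}"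
  let ?Y = "\<lambda>f i j. all_on {(a, j), (i, b)} f * (of_bool (f (i, j)) - p)"
  have nonzero: "(\<Sum>i\<in>?K. ?Y f i j) \<noteq> 0 \<Longrightarrow> f (a, j)" "(\<Sum>j\<in>?J. ?Y f i j) \<noteq> 0 \<Longrightarrow> f (i, b)" for f i j
    by (rule ccontr, erule notE, rule sum.neutral, simp add: all_on_def)+
  have n1: "real (n - Suc 0) * (real (n - Suc 0) * p ^ 3) \<le> (real n)\<^sup>2 * p ^ 3"
  proof -
    have "real (n - Suc 0) * (real (n - Suc 0) * p ^ 3) \<le> real n * (real n * p ^ 3)"
      using p_pos by (intro mult_mono) auto
    then show ?thesis by (simp add: power2_eq_square mult.assoc)
  qed
  have "(\<Sum>j\<in>S f. ((\<Sum>i\<in>T f. of_bool (f (i, j))) - p * real (card (T f)))\<^sup>2)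
      = (\<Sum>j\<in>?J. (\<Sum>i\<in>?K. ?Y f i j)\<^sup>2)" for f
  proof -
    have "(\<Sum>i\<in>T f. of_bool (f (i, j))) - p * real (card (T f)) = (\<Sum>i\<in>T f. of_bool (f (i, j)) - p)" for j
      by (simp add: sum_subtractf)
    also have "(\<Sum>i\<in>T f. of_bool (f (i, j)) - p) = (\<Sum>i\<in>?K. ?Y f i j)" if "j \<in> S f" for j
      by (intro sum.mono_neutral_cong_left)
         (use that in \<open>auto simp: S_def T_def other_nbrs_left_def other_nbrs_right_def all_on_def\<close>)
    finally have "(\<Sum>j\<in>S f. ((\<Sum>i\<in>T f. of_bool (f (i, j))) - p * real (card (T f)))\<^sup>2)
        = (\<Sum>j\<in>S f. (\<Sum>i\<in>?K. ?Y f i j)\<^sup>2)" by simp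
    also have "\<dots> = (\<Sum>j\<in>?J. (\<Sum>i\<in>?K. ?Y f i j)\<^sup>2)"
      by (intro sum.mono_neutral_left) (auto simp: S_def other_nbrs_left_def dest: nonzero)
    finally show ?thesis .
  qed
  then have "measure_pmf.expectation G (\<lambda>f. \<Sum>j\<in>S f. ((\<Sum>i\<in>T f. of_bool (f (i, j))) - p * real (card (T f)))\<^sup>2)
      = (\<Sum>j\<in>?J. measure_pmf.expectation G (\<lambda>f. (\<Sum>i\<in>?K. ?Y f i j)\<^sup>2))"
    by (simp add: Bochner_Integration.integral_sum)
  also have "\<dots> \<le> (\<Sum>j\<in>?J. real (card ?K) * p ^ Suc 2)"
    by (intro sum_mono expectation_sum_square) (use a_less b_less in \<open>auto intro!: inj_onI\<close>)
  also have "\<dots> = real (n - Suc 0) * (real (n - Suc 0) * p ^ 3)"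
    using a_less b_less by (simp add: card_Diff_singleton power3_eq_cube power2_eq_square)
  finally show "measure_pmf.expectation G (\<lambda>f. \<Sum>j\<in>S f. ((\<Sum>i\<in>T f. of_bool (f (i, j))) - p * real (card (T f)))\<^sup>2)
           \<le> (real n)\<^sup>2 * p ^ 3" using n1 by linarith
  have "(\<Sum>i\<in>T f. ((\<Sum>j\<in>S f. of_bool (f (i, j))) - p * real (card (S f)))\<^sup>2)
      = (\<Sum>i\<in>?K. (\<Sum>j\<in>?J. ?Y f i j)\<^sup>2)" for f
  proof -
    have "(\<Sum>j\<in>S f. of_bool (f (i, j))) - p * real (card (S f)) = (\<Sum>j\<in>S f. of_bool (f (i, j)) - p)" for i
      by (simp add: sum_subtractf)
    also have "(\<Sum>j\<in>S f. of_bool (f (i, j)) - p) = (\<Sum>j\<in>?J. ?Y f i j)" if "i \<in> T f" for i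
      by (intro sum.mono_neutral_cong_left)
         (use that in \<open>auto simp: S_def T_def other_nbrs_left_def other_nbrs_right_def all_on_def\<close>)
    finally have "(\<Sum>i\<in>T f. ((\<Sum>j\<in>S f. of_bool (f (i, j))) - p * real (card (S f)))\<^sup>2)
        = (\<Sum>i\<in>T f. (\<Sum>j\<in>?J. ?Y f i j)\<^sup>2)" by simp
    also have "\<dots> = (\<Sum>i\<in>?K. (\<Sum>j\<in>?J. ?Y f i j)\<^sup>2)"
      by (intro sum.mono_neutral_left) (auto simp: T_def other_nbrs_right_def dest: nonzero)
    finally show ?thesis .
  qed
  then have "measure_pmf.expectation G (\<lambda>f. \<Sum>i\<in>T f. ((\<Sum>j\<in>S f. of_bool (f (i, j))) - p * real (card (S f)))\<^sup>2)
      = (\<Sum>i\<in>?K. measure_pmf.expectation G (\<lambda>f. (\<Sum>j\<in>?J. ?Y f i j)\<^sup>2))"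
    by (simp add: Bochner_Integration.integral_sum)
  also have "\<dots> \<le> (\<Sum>i\<in>?K. real (card ?J) * p ^ Suc 2)"
    by (intro sum_mono expectation_sum_square) (use a_less b_less in \<open>auto intro!: inj_onI\<close>)
  also have "\<dots> = real (n - Suc 0) * (real (n - Suc 0) * p ^ 3)"
    using a_less b_less by (simp add: card_Diff_singleton power3_eq_cube power2_eq_square)
  finally show "measure_pmf.expectation G (\<lambda>f. \<Sum>i\<in>T f. ((\<Sum>j\<in>S f. of_bool (f (i, j))) - p * real (card (S f)))\<^sup>2)
           \<le> (real n)\<^sup>2 * p ^ 3" using n1 by linarith
qed

end

section \<open>Limits\<close>

text \<open>The binomial coefficient times the power of \<open>p\<close> tends to
  \<open>lam ^ k / fact k\<close>, and the power of \<open>1 - p\<close> to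
  \<open>exp (- lam)\<close>. There are \<open>n - 1\<close> trials because the edge (a, b) is not
  counted.\<close>

lemma binomial_poisson_limit:
  fixes p :: "nat \<Rightarrow> real"
  assumes p: "\<And>n. 0 \<le> p n" "\<And>n. p n \<le> 1" and lim: "(\<lambda>n. real n * p n) \<longlonglongrightarrow> lam" and lam: "0 < lam"
  shows "(\<lambda>n. pmf (binomial_pmf (n - 1) (p n)) k) \<longlonglongrightarrow> pmf (poisson_pmf lam) k"
proof -
  have "(\<lambda>n. (real n * p n) * (1 / real n)) \<longlonglongrightarrow> lam * 0"
    by (intro tendsto_mult lim lim_1_over_n)
  then have p0: "p \<longlonglongrightarrow> 0"
    by (rule Lim_transform_eventually[THEN tendsto_eq_rhs])
       (rule eventually_mono[OF eventually_gt_at_top[of 0]], auto)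
  then have p_half: "\<forall>\<^sub>F n in sequentially. p n < 1 / 2"
    by (rule order_tendstoD) simp
  have shift: "(\<lambda>n. (real (n - 1) - real i) * p n) \<longlonglongrightarrow> lam" for i
  proof -
    have "(\<lambda>n. real n * p n - (1 + real i) * p n) \<longlonglongrightarrow> lam - (1 + real i) * 0"
      by (intro tendsto_intros lim p0)
    then show ?thesis
      by (rule Lim_transform_eventually[THEN tendsto_eq_rhs])
         (rule eventually_mono[OF eventually_gt_at_top[of 0]], auto simp: of_nat_diff algebra_simps)
  qed
  have "(\<lambda>n. (\<Prod>i<k. (real (n - 1) - real i) * p n) / fact k) \<longlonglongrightarrow> (\<Prod>i<k. lam) / fact k"
    by (intro tendsto_intros shift) auto
  moreover have "(\<Prod>i<k. (real (n - 1) - real i) * p n) / fact k = real ((n - 1) choose k) * p n ^ k" for n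
    by (simp add: binomial_gbinomial gbinomial_prod_rev prod.distrib atLeast0LessThan)
  ultimately have l1: "(\<lambda>n. real ((n - 1) choose k) * p n ^ k) \<longlonglongrightarrow> lam ^ k / fact k"
    by simp
  \<comment> \<open>Squeezed by -p - 2 p^2 <= ln (1 - p) <= -p, valid once p < 1/2; the quadratic
    correction vanishes because p tends to 0.\<close>
  have "(\<lambda>n. (real (n - 1) - real k) * ln (1 - p n)) \<longlonglongrightarrow> - lam"
  proof (rule tendsto_sandwich)
    have "(\<lambda>n. - ((real (n - 1) - real k) * p n) * (1 + 2 * p n)) \<longlonglongrightarrow> - lam * (1 + 2 * 0)"
      by (intro tendsto_intros shift p0)
    then show "(\<lambda>n. - ((real (n - 1) - real k) * p n) * (1 + 2 * p n)) \<longlonglongrightarrow> - lam" by simp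
    show "(\<lambda>n. - ((real (n - 1) - real k) * p n)) \<longlonglongrightarrow> - lam"
      by (intro tendsto_intros shift)
    have ev: "\<forall>\<^sub>F n in sequentially. p n < 1 / 2 \<and> k + 1 < n"
      using p_half eventually_gt_at_top[of "k + 1"]
      by (intro eventually_conj) auto
    show "\<forall>\<^sub>F n in sequentially. - ((real (n - 1) - real k) * p n) * (1 + 2 * p n)
        \<le> (real (n - 1) - real k) * ln (1 - p n)"
      using ev
    proof eventually_elim
      case (elim n)
      have "(real (n - 1) - real k) * (- p n - 2 * (p n)\<^sup>2) \<le> (real (n - 1) - real k) * ln (1 - p n)"
        using elim p ln_one_minus_pos_lower_bound[of "p n"] by (intro mult_left_mono) auto
      then show ?case by (simp add: algebra_simps power2_eq_square)
    qed
    show "\<forall>\<^sub>F n in sequentially. (real (n - 1) - real k) * ln (1 - p n) \<le> - ((real (n - 1) - real k) * p n)"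
      using ev
    proof eventually_elim
      case (elim n)
      have "(real (n - 1) - real k) * ln (1 - p n) \<le> (real (n - 1) - real k) * (- p n)"
        using elim ln_add_one_self_le_self2[of "- p n"] by (intro mult_left_mono) auto
      then show ?case by simp
    qed
  qed
  then have "(\<lambda>n. exp ((real (n - 1) - real k) * ln (1 - p n))) \<longlonglongrightarrow> exp (- lam)"
    by (intro tendsto_intros)
  then have "(\<lambda>n. (1 - p n) ^ (n - 1 - k)) \<longlonglongrightarrow> exp (- lam)"
  proof (rule Lim_transform_eventually)
    show "\<forall>\<^sub>F n in sequentially. exp ((real (n - 1) - real k) * ln (1 - p n)) = (1 - p n) ^ (n - 1 - k)"
      using p_half eventually_gt_at_top[of "k + 1"]
    proof eventually_elim
      case (elim n)
      then have "real (n - 1) - real k = real (n - 1 - k)" by (simp add: of_nat_diff)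
      moreover have "0 < 1 - p n" using elim by simp
      ultimately show ?case by (simp only: exp_of_nat_mult exp_ln)
    qed
  qed
  from tendsto_mult[OF l1 this] show ?thesis
    using p lam by simp
qed

text \<open>Exhausting \<open>A\<close> by finite sets gives an asymptotic lower bound for every
  \<open>A\<close>. Applied to the complement it gives the upper bound, since all the laws have
  total mass 1 and no mass can escape.\<close>

lemma pmf_pointwise_tendsto_imp_prob_tendsto:
  fixes M :: "nat \<Rightarrow> 'a::countable pmf"
  assumes lim: "\<And>x. (\<lambda>n. pmf (M n) x) \<longlonglongrightarrow> pmf L x"
  shows "(\<lambda>n. measure_pmf.prob (M n) A) \<longlonglongrightarrow> measure_pmf.prob L A"
proof -
  have lower: "\<forall>\<^sub>F n in sequentially. c < measure_pmf.prob (M n) A"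
    if c: "c < measure_pmf.prob L A" for c A
  proof -
    define F where "F m = A \<inter> to_nat -` {..m}" for m :: nat
    have fin: "finite (F m)" for m
      by (auto simp: F_def intro!: finite_Int finite_vimageI)
    have "(\<lambda>m. measure_pmf.prob L (F m)) \<longlonglongrightarrow> measure_pmf.prob L (\<Union>m. F m)"
      by (rule measure_pmf.finite_Lim_measure_incseq) (auto simp: F_def incseq_def)
    moreover have "(\<Union>m. F m) = A" by (auto simp: F_def)
    ultimately have "\<forall>\<^sub>F m in sequentially. c < measure_pmf.prob L (F m)"
      using c by (auto dest: order_tendstoD)
    then obtain m where m: "c < measure_pmf.prob L (F m)"
      by (auto simp: eventually_sequentially)
    have "(\<lambda>n. measure_pmf.prob (M n) (F m)) \<longlonglongrightarrow> measure_pmf.prob L (F m)"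
      unfolding measure_measure_pmf_finite[OF fin] by (intro tendsto_intros lim)
    then have "\<forall>\<^sub>F n in sequentially. c < measure_pmf.prob (M n) (F m)"
      using m by (rule order_tendstoD)
    then show ?thesis
    proof eventually_elim
      case (elim n)
      moreover have "measure_pmf.prob (M n) (F m) \<le> measure_pmf.prob (M n) A"
        by (rule measure_pmf.finite_measure_mono) (auto simp: F_def)
      ultimately show ?case by linarith
    qed
  qed
  have compl: "measure_pmf.prob N (- A) = 1 - measure_pmf.prob N A" for N :: "'a pmf"
    using measure_pmf.prob_compl[of A N] by (simp add: Compl_eq_Diff_UNIV)
  show ?thesis
  proof (rule order_tendstoI)
    fix c assume "measure_pmf.prob L A < c"
    then have "1 - c < measure_pmf.prob L (- A)" by (simp add: compl)
    from lower[OF this] show "\<forall>\<^sub>F n in sequentially. measure_pmf.prob (M n) A < c"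
      by eventually_elim (simp add: compl)
  qed (rule lower)
qed

lemma prob_Un3_le:
  "measure_pmf.prob M (A \<union> B \<union> C) \<le> measure_pmf.prob M A + measure_pmf.prob M B + measure_pmf.prob M C"
  using measure_Un_le[of "A \<union> B" M C] measure_Un_le[of A M B] by simp

lemma cross_edges_nonneg: "0 \<le> cross_edges n a b f"
  by (simp add: cross_edges_def sum_nonneg)

text \<open>The count is an integer, so Markov's inequality at level 1 controls the presence of any
  cross edge.\<close>

lemma cross_edges_ge_1: "cross_edges n a b f \<noteq> 0 \<Longrightarrow> 1 \<le> cross_edges n a b f"
proof -
  have "cross_edges n a b f =
      real (\<Sum>j\<in>other_nbrs_left n a b f. \<Sum>i\<in>other_nbrs_right n a b f. of_bool (f (i, j)))"
    by (simp only: cross_edges_def of_nat_sum of_nat_of_bool)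
  then obtain m :: nat where "cross_edges n a b f = real m" by blast
  then show "cross_edges n a b f \<noteq> 0 \<Longrightarrow> 1 \<le> cross_edges n a b f" by simp
qed

section \<open>Probability estimates for finite n in the four regimes\<close>

context bip_model
begin

text \<open>The two counts depend on disjoint sets of edges, the row of \<open>a\<close> and the
  column of \<open>b\<close> without their common entry (a, b); hence they are independent.\<close>

lemma map_pmf_card_other_nbrs:
  "map_pmf (\<lambda>f. (card (other_nbrs_left n a b f), card (other_nbrs_right n a b f))) G
     = pair_pmf (binomial_pmf (n - 1) p) (binomial_pmf (n - 1) p)"
proof -
  define A where "A = {a} \<times> ({..<n} - {b})"
  define B where "B = ({..<n} - {a}) \<times> {b}"
  \<comment> \<open>Splitting the product into \<open>A\<close> and its complement puts all of
    \<open>B\<close>, and also the forced coordinate, into \<open>C\<close>; the marginal on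
    \<open>B\<close> is taken afterwards.\<close>
  define C where "C = {..<n} \<times> {..<n} - A"
  let ?q = "\<lambda>z. bernoulli_pmf (if z = (a, b) then 1 else p)"
  have fin: "finite A" "finite B" "finite C" by (auto simp: A_def B_def C_def)
  have BC: "B \<subseteq> C" using b_less by (auto simp: A_def B_def C_def)
  have AC: "A \<inter> C = {}" "{..<n} \<times> {..<n} = A \<union> C" using a_less by (auto simp: A_def C_def)
  have cA: "card (other_nbrs_left n a b f) = card {z \<in> A. f z}" for f
    by (rule bij_betw_same_card[of "Pair a"])
       (auto simp: A_def other_nbrs_left_def bij_betw_def inj_on_def)
  have cB: "card (other_nbrs_right n a b f) = card {z \<in> B. f z}" for f
    by (rule bij_betw_same_card[of "\<lambda>i. (i, b)"])
       (auto simp: B_def other_nbrs_right_def bij_betw_def inj_on_def)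
  have cardAB: "card A = n - 1" "card B = n - 1"
    using a_less b_less by (simp_all add: A_def B_def card_cartesian_product card_Diff_singleton)
  have "map_pmf (\<lambda>f. (card (other_nbrs_left n a b f), card (other_nbrs_right n a b f))) G
      = map_pmf (\<lambda>(f, g). (card {z \<in> A. f z}, card {z \<in> B. g z}))
          (pair_pmf (Pi_pmf A False ?q) (Pi_pmf C False ?q))"
    unfolding G_eq AC(2) Pi_pmf_union[OF fin(1,3) AC(1)] map_pmf_comp
  proof (rule map_pmf_cong[OF refl])
    fix x assume "x \<in> set_pmf (pair_pmf (Pi_pmf A False ?q) (Pi_pmf C False ?q))"
    have "{z \<in> A. if z \<in> A then fst x z else snd x z} = {z \<in> A. fst x z}" by auto
    moreover have "{z \<in> B. if z \<in> A then fst x z else snd x z} = {z \<in> B. snd x z}"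
      using BC AC by auto
    ultimately show
      "(card (other_nbrs_left n a b (case x of (f, g) \<Rightarrow> \<lambda>x. if x \<in> A then f x else g x)),
        card (other_nbrs_right n a b (case x of (f, g) \<Rightarrow> \<lambda>x. if x \<in> A then f x else g x)))
       = (case x of (f, g) \<Rightarrow> (card {z \<in> A. f z}, card {z \<in> B. g z}))"
      by (simp add: cA cB case_prod_unfold)
  qed
  also have "\<dots> = pair_pmf (map_pmf (\<lambda>f. card {z \<in> A. f z}) (Pi_pmf A False ?q))
                           (map_pmf (\<lambda>f. card {z \<in> B. f z}) (Pi_pmf C False ?q))"
    by (rule map_pair)
  also have "Pi_pmf A False ?q = Pi_pmf A False (\<lambda>_. bernoulli_pmf p)"
    by (rule Pi_pmf_cong) (auto simp: A_def)
  also have "map_pmf (\<lambda>f. card {z \<in> A. f z}) \<dots> = binomial_pmf (n - 1) p"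
    by (rule binomial_pmf_altdef'[symmetric]) (use fin cardAB p_pos p_le_1 in auto)
  also have "map_pmf (\<lambda>f. card {z \<in> B. f z}) (Pi_pmf C False ?q)
      = map_pmf (\<lambda>f. card {z \<in> B. f z}) (Pi_pmf B False ?q)"
    unfolding Pi_pmf_subset[OF fin(3) BC] map_pmf_comp by (intro map_pmf_cong refl arg_cong[of _ _ card]) auto
  also have "Pi_pmf B False ?q = Pi_pmf B False (\<lambda>_. bernoulli_pmf p)"
    by (rule Pi_pmf_cong) (auto simp: B_def)
  also have "map_pmf (\<lambda>f. card {z \<in> B. f z}) \<dots> = binomial_pmf (n - 1) p"
    by (rule binomial_pmf_altdef'[symmetric]) (use fin cardAB p_pos p_le_1 in auto)
  finally show ?thesis .
qed

lemma prob_edge_isolated_ge: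
  "1 - 2 * (real n * p) \<le> measure_pmf.prob G {f. edge_isolated n a b f \<and> kappa n a b f = 0}"
proof -
  let ?X = "{f. edge_isolated n a b f \<and> kappa n a b f = 0}"
  let ?S = "{f. 1 \<le> real (card (other_nbrs_left n a b f))}"
  let ?T = "{f. 1 \<le> real (card (other_nbrs_right n a b f))}"
  have "1 - measure_pmf.prob G ?X = measure_pmf.prob G (- ?X)"
    using measure_pmf.prob_compl[of ?X G] by (simp add: Compl_eq_Diff_UNIV)
  also have "\<dots> \<le> measure_pmf.prob G (?S \<union> ?T)"
  proof (rule prob_mono_supp, rule ccontr)
    fix f assume f: "f \<in> set_pmf G" "f \<in> - ?X" "f \<notin> ?S \<union> ?T"
    interpret bip_edge n a b f by (rule bip_edge_supp[OF f(1)])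
    have ST: "S = {}" "T = {}" using f(3) by (auto simp: not_le Suc_le_eq card_gt_0_iff)
    then have "cross_edges n a b f = 0" by (simp add: cross_edges_def)
    from kappa_no_cross_edges[OF this] have "kappa n a b f = 0" by (simp add: ST)
    moreover have "edge_isolated n a b f"
      using ST by (auto simp: edge_isolated_def other_nbrs_left_def other_nbrs_right_def)
    ultimately show False using f(2) by simp
  qed
  also have "\<dots> \<le> measure_pmf.prob G ?S + measure_pmf.prob G ?T"
    by (rule measure_Un_le) auto
  also have "\<dots> \<le> real n * p / 1 + real n * p / 1"
    by (intro add_mono markov_G expectation_card_other_nbrs) auto
  finally show ?thesis by (simp add: algebra_simps)
qed

text \<open>Unless a cross edge exists, the curvature is a function of the two degrees, whose joint
  law is known. The error is at most the expected number of cross edges.\<close>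

lemma prob_kappa_le_approx:
  "\<bar>measure_pmf.prob G {f. kappa n a b f \<le> x} -
    measure_pmf.prob (pair_pmf (binomial_pmf (n - 1) p) (binomial_pmf (n - 1) p))
      {(x1, x2). - 2 * max (1 - 1 / (1 + real x1) - 1 / (1 + real x2)) 0 \<le> x}\<bar>
   \<le> (real n)\<^sup>2 * p ^ 3"
proof -
  let ?A = "{f. kappa n a b f \<le> x}"
  let ?R = "{(x1, x2). - 2 * max (1 - 1 / (1 + real x1) - 1 / (1 + real x2)) 0 \<le> x}"
  let ?h = "\<lambda>f. (card (other_nbrs_left n a b f), card (other_nbrs_right n a b f))"
  let ?B = "?h -` ?R"
  let ?D = "{f. 1 \<le> cross_edges n a b f}"
  have iff: "f \<in> ?A \<longleftrightarrow> f \<in> ?B" if f: "f \<in> set_pmf G" "f \<notin> ?D" for f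
  proof -
    interpret bip_edge n a b f by (rule bip_edge_supp[OF f(1)])
    have "cross_edges n a b f = 0" using cross_edges_ge_1 f(2) by blast
    from kappa_no_cross_edges[OF this] show ?thesis by simp
  qed
  have "measure_pmf.prob G ?A \<le> measure_pmf.prob G (?B \<union> ?D)"
       "measure_pmf.prob G ?B \<le> measure_pmf.prob G (?A \<union> ?D)"
    by (rule prob_mono_supp; use iff in blast)+
  moreover have "measure_pmf.prob G (?B \<union> ?D) \<le> measure_pmf.prob G ?B + measure_pmf.prob G ?D"
       "measure_pmf.prob G (?A \<union> ?D) \<le> measure_pmf.prob G ?A + measure_pmf.prob G ?D"
    by (rule measure_Un_le; simp)+
  moreover have "measure_pmf.prob G ?D \<le> (real n)\<^sup>2 * p ^ 3 / 1"
    by (rule markov_G) (auto simp: cross_edges_nonneg expectation_cross_edges)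
  moreover have "measure_pmf.prob G ?B = measure_pmf.prob (map_pmf ?h G) ?R"
    by (simp only: measure_map_pmf)
  ultimately show ?thesis unfolding map_pmf_card_other_nbrs by linarith
qed

text \<open>Outside the three bad events, \<open>kappa_le\<close> gives a deviation of at most 2 (8
  / (np) + eps / 4). The condition on np makes 8 / (np) at most eps / 4, so the total is at most
  eps.\<close>

lemma prob_kappa_far_from_minus_2:
  assumes \<epsilon>: "0 < \<epsilon>" and n: "2 \<le> n" and np: "32 / \<epsilon> \<le> real n * p"
  shows "measure_pmf.prob G {f. \<bar>kappa n a b f - (- 2)\<bar> > \<epsilon>}
           \<le> 32 / (real n * p) + 16 / \<epsilon> * (real n * p\<^sup>2)"
proof -
  let ?m = "real n * p"
  have m0: "0 < ?m" using n p_pos by simp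
  let ?A = "{f. real (card (other_nbrs_left n a b f)) < ?m / 4}"
  let ?B = "{f. real (card (other_nbrs_right n a b f)) < ?m / 4}"
  let ?C = "{f. \<epsilon> / 16 * ?m \<le> cross_edges n a b f}"
  have "measure_pmf.prob G {f. \<bar>kappa n a b f - (- 2)\<bar> > \<epsilon>} \<le> measure_pmf.prob G (?A \<union> ?B \<union> ?C)"
  proof (rule prob_mono_supp, rule ccontr)
    fix f assume f: "f \<in> set_pmf G" "f \<in> {f. \<bar>kappa n a b f - (- 2)\<bar> > \<epsilon>}" "f \<notin> ?A \<union> ?B \<union> ?C"
    interpret bip_edge n a b f by (rule bip_edge_supp[OF f(1)])
    let ?K = "cross_edges n a b f"
    have s: "?m / 4 \<le> 1 + real (card S)" and t: "?m / 4 \<le> 1 + real (card T)"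
      and K: "?K \<le> \<epsilon> / 16 * ?m"
      using f(3) by auto
    have "(1 + ?K) / (1 + real (card S)) \<le> (1 + ?K) / (?m / 4)"
      using s m0 cross_edges_nonneg[of n a b f] by (intro divide_left_mono mult_pos_pos) auto
    also have "\<dots> \<le> (1 + \<epsilon> / 16 * ?m) / (?m / 4)"
      using K m0 by (intro divide_right_mono) auto
    also have "\<dots> = 4 / ?m + \<epsilon> / 4"
      using n p_pos by (simp add: field_simps)
    finally have 1: "(1 + ?K) / (1 + real (card S)) \<le> 4 / ?m + \<epsilon> / 4" .
    have "1 / (1 + real (card T)) \<le> 1 / (?m / 4)"
      using t m0 by (intro divide_left_mono mult_pos_pos) auto
    then have 2: "1 / (1 + real (card T)) \<le> 4 / ?m" by simp
    have 3: "4 / ?m \<le> \<epsilon> / 8"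
      using np \<epsilon> m0 by (simp add: field_simps)
    have "kappa n a b f + 2 \<le> \<epsilon>"
      using kappa_le 1 2 3 by argo
    then show False using f(2) kappa_ge by auto
  qed
  also have "\<dots> \<le> measure_pmf.prob G ?A + measure_pmf.prob G ?B + measure_pmf.prob G ?C"
    by (rule prob_Un3_le)
  also have "\<dots> \<le> 16 / ?m + 16 / ?m + (real n)\<^sup>2 * p ^ 3 / (\<epsilon> / 16 * ?m)"
    using n p_pos \<epsilon> by (intro add_mono prob_few_other_nbrs markov_G)
       (auto simp: cross_edges_nonneg expectation_cross_edges)
  also have "\<dots> = 32 / ?m + 16 / \<epsilon> * (real n * p\<^sup>2)"
    using n p_pos \<epsilon> by (simp add: field_simps power2_eq_square power3_eq_cube)
  finally show ?thesis .
qed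

text \<open>With degrees at least np / 4, \<open>kappa_ge_second_moment\<close> loses 16 / (np) + 8
  delta. Each of these two terms is at most eps / 2 by the condition on np and the choice of
  delta.\<close>

lemma prob_kappa_far_from_0:
  assumes \<epsilon>: "0 < \<epsilon>" and n: "2 \<le> n" and np: "32 / \<epsilon> \<le> real n * p"
  shows "measure_pmf.prob G {f. \<bar>kappa n a b f\<bar> > \<epsilon>}
           \<le> 32 / (real n * p) + 2 * 16384 / \<epsilon>\<^sup>2 / (real n * p\<^sup>2)"
proof -
  let ?m = "real n * p"
  have m0: "0 < ?m" using n p_pos by simp
  define \<delta> where "\<delta> = \<epsilon> / 16"
  \<comment> \<open>Chosen so that the second moment term in \<open>kappa_ge_second_moment\<close>
    with \<open>m = n * p / 4\<close> equals \<open>\<delta>\<close>. Markov's inequality then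
    yields 64 / (delta^2 n p^2), whence the constant 16384 = 64 * 16^2.\<close>
  define Q where "Q = \<delta>\<^sup>2 / 64 * (real n ^ 3 * p ^ 5)"
  have \<delta>: "0 < \<delta>" using \<epsilon> by (simp add: \<delta>_def)
  have Q0: "0 < Q" using \<delta> n p_pos by (simp add: Q_def)
  define q1 where "q1 f = (\<Sum>j\<in>other_nbrs_left n a b f.
      ((\<Sum>i\<in>other_nbrs_right n a b f. of_bool (f (i, j))) - p * real (card (other_nbrs_right n a b f)))\<^sup>2)" for f
  define q2 where "q2 f = (\<Sum>i\<in>other_nbrs_right n a b f.
      ((\<Sum>j\<in>other_nbrs_left n a b f. of_bool (f (i, j))) - p * real (card (other_nbrs_left n a b f)))\<^sup>2)" for f
  let ?A = "{f. real (card (other_nbrs_left n a b f)) < ?m / 4}"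
  let ?B = "{f. real (card (other_nbrs_right n a b f)) < ?m / 4}"
  let ?C = "{f. Q \<le> q1 f}" and ?D = "{f. Q \<le> q2 f}"
  have "measure_pmf.prob G {f. \<bar>kappa n a b f\<bar> > \<epsilon>} \<le> measure_pmf.prob G (?A \<union> ?B \<union> ?C \<union> ?D)"
  proof (rule prob_mono_supp, rule ccontr)
    fix f assume f: "f \<in> set_pmf G" "f \<in> {f. \<bar>kappa n a b f\<bar> > \<epsilon>}" "f \<notin> ?A \<union> ?B \<union> ?C \<union> ?D"
    interpret bip_edge n a b f by (rule bip_edge_supp[OF f(1)])
    have "kappa n a b f \<ge> - 4 * (1 / (?m / 4) + Q / (\<delta> * p\<^sup>2 * (?m / 4) ^ 3) + \<delta>)"
      by (rule kappa_ge_second_moment) (use f(3) m0 \<delta> p_pos in \<open>auto simp: q1_def q2_def\<close>)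
    also have "Q / (\<delta> * p\<^sup>2 * (?m / 4) ^ 3) = \<delta>"
      using \<delta> n p_pos by (simp add: Q_def field_simps eval_nat_numeral)
    finally have "kappa n a b f \<ge> - (16 / ?m) - 8 * \<delta>" by simp
    moreover have "16 / ?m \<le> \<epsilon> / 2"
      using np \<epsilon> m0 by (simp add: field_simps)
    ultimately have "kappa n a b f \<ge> - \<epsilon>" by (simp add: \<delta>_def)
    then show False using f(2) kappa_nonpos by auto
  qed
  also have "\<dots> \<le> measure_pmf.prob G (?A \<union> ?B \<union> ?C) + measure_pmf.prob G ?D"
    by (rule measure_Un_le) auto
  also have "measure_pmf.prob G (?A \<union> ?B \<union> ?C) \<le> measure_pmf.prob G ?A + measure_pmf.prob G ?B + measure_pmf.prob G ?C"
    by (rule prob_Un3_le)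
  also have "measure_pmf.prob G ?A + measure_pmf.prob G ?B + measure_pmf.prob G ?C + measure_pmf.prob G ?D
      \<le> 16 / ?m + 16 / ?m + (real n)\<^sup>2 * p ^ 3 / Q + (real n)\<^sup>2 * p ^ 3 / Q"
  proof (intro add_mono prob_few_other_nbrs n)
    show "measure_pmf.prob G ?C \<le> (real n)\<^sup>2 * p ^ 3 / Q"
      by (rule markov_G) (use Q0 expectation_discrepancy(1) in \<open>auto simp: q1_def sum_nonneg\<close>)
    show "measure_pmf.prob G ?D \<le> (real n)\<^sup>2 * p ^ 3 / Q"
      by (rule markov_G) (use Q0 expectation_discrepancy(2) in \<open>auto simp: q2_def sum_nonneg\<close>)
  qed
  also have "(real n)\<^sup>2 * p ^ 3 / Q = 16384 / \<epsilon>\<^sup>2 / (real n * p\<^sup>2)"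
    using n p_pos \<epsilon> by (simp add: Q_def \<delta>_def field_simps eval_nat_numeral)
  finally show ?thesis by (simp add: mult_ac)
qed

end

section \<open>Passage to the limit in the four regimes\<close>

theorem theorem5p5:
  fixes p :: "nat \<Rightarrow> real" and a b :: nat
  assumes p_pos: "\<And>n. 0 < p n" and p_le1: "\<And>n. p n \<le> 1"
  shows
   "((\<lambda>n. real n * p n) \<longlonglongrightarrow> 0 \<longrightarrow>
       (\<lambda>n. measure_pmf.prob (bip_graph_cond_pmf n (p n) a b)
               {f. edge_isolated n a b f \<and> kappa n a b f = 0}) \<longlonglongrightarrow> 1)
  \<and> (\<forall>lam::real. 0 < lam \<longrightarrow> (\<lambda>n. real n * p n) \<longlonglongrightarrow> lam \<longrightarrow>
       weak_conv_m
         (\<lambda>n. measure_pmf (map_pmf (kappa n a b) (bip_graph_cond_pmf n (p n) a b)))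
         (measure_pmf (map_pmf
            (\<lambda>(x1, x2). - 2 * max (1 - 1 / (1 + real x1) - 1 / (1 + real x2)) 0)
            (pair_pmf (poisson_pmf lam) (poisson_pmf lam)))))
  \<and> (filterlim (\<lambda>n. real n * p n) at_top sequentially \<and> (\<lambda>n. real n * (p n)\<^sup>2) \<longlonglongrightarrow> 0 \<longrightarrow>
       (\<forall>\<epsilon>>0. (\<lambda>n. measure_pmf.prob (bip_graph_cond_pmf n (p n) a b)
               {f. \<bar>kappa n a b f - (- 2)\<bar> > \<epsilon>}) \<longlonglongrightarrow> 0))
  \<and> (filterlim (\<lambda>n. real n * (p n)\<^sup>2) at_top sequentially \<longrightarrow>
       (\<forall>\<epsilon>>0. (\<lambda>n. measure_pmf.prob (bip_graph_cond_pmf n (p n) a b)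
               {f. \<bar>kappa n a b f\<bar> > \<epsilon>}) \<longlonglongrightarrow> 0))"
proof (intro conjI impI allI)
  \<comment> \<open>The endpoints \<open>a\<close> and \<open>b\<close> are fixed indices, so they
    are vertices of the graph only for large n.\<close>
  have ev: "\<forall>\<^sub>F n in sequentially. 2 \<le> n \<and> bip_model n a b (p n)"
    using eventually_gt_at_top[of "a + b + 2"]
    by eventually_elim (auto simp: bip_model_def p_pos p_le1)
  {
    assume lim: "(\<lambda>n. real n * p n) \<longlonglongrightarrow> 0"
    show "(\<lambda>n. measure_pmf.prob (bip_graph_cond_pmf n (p n) a b)
               {f. edge_isolated n a b f \<and> kappa n a b f = 0}) \<longlonglongrightarrow> 1"
    proof (rule tendsto_sandwich)
      have "(\<lambda>n. 1 - 2 * (real n * p n)) \<longlonglongrightarrow> 1 - 2 * 0"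
        by (intro tendsto_intros lim)
      then show "(\<lambda>n. 1 - 2 * (real n * p n)) \<longlonglongrightarrow> 1" by simp
      show "\<forall>\<^sub>F n in sequentially. 1 - 2 * (real n * p n) \<le>
          measure_pmf.prob (bip_graph_cond_pmf n (p n) a b)
            {f. edge_isolated n a b f \<and> kappa n a b f = 0}"
        using ev by eventually_elim (auto intro: bip_model.prob_edge_isolated_ge)
    qed auto
  next
    fix lam :: real
    assume lam: "0 < lam" and lim: "(\<lambda>n. real n * p n) \<longlonglongrightarrow> lam"
    let ?g = "\<lambda>(x1, x2). - 2 * max (1 - 1 / (1 + real x1) - 1 / (1 + real x2)) 0"
    let ?L = "pair_pmf (poisson_pmf lam) (poisson_pmf lam)"
    let ?B = "\<lambda>n. pair_pmf (binomial_pmf (n - 1) (p n)) (binomial_pmf (n - 1) (p n))"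
    have "(\<lambda>n. measure_pmf.prob (bip_graph_cond_pmf n (p n) a b) {f. kappa n a b f \<le> x})
        \<longlonglongrightarrow> measure_pmf.prob ?L {y. ?g y \<le> x}" for x
    proof -
      have "(\<lambda>n. pmf (?B n) z) \<longlonglongrightarrow> pmf ?L z" for z
        by (cases z) (auto simp only: pmf_pair intro!: tendsto_mult binomial_poisson_limit
              lim lam p_le1 less_imp_le[OF p_pos])
      then have B: "(\<lambda>n. measure_pmf.prob (?B n) {y. ?g y \<le> x}) \<longlonglongrightarrow> measure_pmf.prob ?L {y. ?g y \<le> x}"
        by (rule pmf_pointwise_tendsto_imp_prob_tendsto)
      \<comment> \<open>The bound on the expected number of cross edges, written as (np)^3 /
        n.\<close>
      have "(\<lambda>n. (real n * p n) ^ 3 * (1 / real n)) \<longlonglongrightarrow> lam ^ 3 * 0"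
        by (intro tendsto_intros lim lim_1_over_n)
      then have e: "(\<lambda>n. (real n)\<^sup>2 * p n ^ 3) \<longlonglongrightarrow> 0"
        by (rule Lim_transform_eventually[THEN tendsto_eq_rhs])
           (rule eventually_mono[OF eventually_gt_at_top[of 0]], auto simp: eval_nat_numeral)
      have "(\<lambda>n. measure_pmf.prob (bip_graph_cond_pmf n (p n) a b) {f. kappa n a b f \<le> x}
          - measure_pmf.prob (?B n) {y. ?g y \<le> x}) \<longlonglongrightarrow> 0"
      proof (rule Lim_null_comparison[OF _ e])
        show "\<forall>\<^sub>F n in sequentially.
            norm (measure_pmf.prob (bip_graph_cond_pmf n (p n) a b) {f. kappa n a b f \<le> x}
              - measure_pmf.prob (?B n) {y. ?g y \<le> x}) \<le> (real n)\<^sup>2 * p n ^ 3"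
          using ev
        proof eventually_elim
          case (elim n)
          then interpret bip_model n a b "p n" by simp
          have "{y. ?g y \<le> x} = {(x1, x2). - 2 * max (1 - 1 / (1 + real x1) - 1 / (1 + real x2)) 0 \<le> x}"
            by auto
          then show ?case using prob_kappa_le_approx[of x] by simp
        qed
      qed
      from tendsto_add[OF this B] show ?thesis by simp
    qed
    \<comment> \<open>The distribution functions converge at every real x, in particular at the
      continuity points of the limit.\<close>
    then show "weak_conv_m
         (\<lambda>n. measure_pmf (map_pmf (kappa n a b) (bip_graph_cond_pmf n (p n) a b)))
         (measure_pmf (map_pmf ?g ?L))"
      by (simp add: weak_conv_m_def weak_conv_def cdf_def vimage_def)
  next
    fix \<epsilon> :: real
    assume "filterlim (\<lambda>n. real n * p n) at_top sequentially \<and> (\<lambda>n. real n * (p n)\<^sup>2) \<longlonglongrightarrow> 0"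
      and \<epsilon>: "0 < \<epsilon>"
    then have np: "filterlim (\<lambda>n. real n * p n) at_top sequentially"
      and np2: "(\<lambda>n. real n * (p n)\<^sup>2) \<longlonglongrightarrow> 0" by auto
    show "(\<lambda>n. measure_pmf.prob (bip_graph_cond_pmf n (p n) a b)
               {f. \<bar>kappa n a b f - (- 2)\<bar> > \<epsilon>}) \<longlonglongrightarrow> 0"
    proof (rule Lim_null_comparison)
      have "(\<lambda>n. 32 / (real n * p n) + 16 / \<epsilon> * (real n * (p n)\<^sup>2)) \<longlonglongrightarrow> 0 + 16 / \<epsilon> * 0"
        by (intro tendsto_add tendsto_mult tendsto_const np2 real_tendsto_divide_at_top[OF tendsto_const np])
      then show "(\<lambda>n. 32 / (real n * p n) + 16 / \<epsilon> * (real n * (p n)\<^sup>2)) \<longlonglongrightarrow> 0" by simp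
      have "\<forall>\<^sub>F n in sequentially. 32 / \<epsilon> \<le> real n * p n"
        using np by (simp add: filterlim_at_top)
      with ev show "\<forall>\<^sub>F n in sequentially.
          norm (measure_pmf.prob (bip_graph_cond_pmf n (p n) a b) {f. \<bar>kappa n a b f - (- 2)\<bar> > \<epsilon>})
            \<le> 32 / (real n * p n) + 16 / \<epsilon> * (real n * (p n)\<^sup>2)"
      proof eventually_elim
        case (elim n)
        then show ?case
          using bip_model.prob_kappa_far_from_minus_2[of n a b "p n" \<epsilon>] \<epsilon> by simp
      qed
    qed
  next
    fix \<epsilon> :: real
    assume np2: "filterlim (\<lambda>n. real n * (p n)\<^sup>2) at_top sequentially" and \<epsilon>: "0 < \<epsilon>"
    \<comment> \<open>Since \<open>p n \<le> 1\<close>, the divergence of n p^2 forces that of np,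
      which is needed for large degrees.\<close>
    have np: "filterlim (\<lambda>n. real n * p n) at_top sequentially"
    proof (rule filterlim_at_top_mono[OF np2], rule always_eventually, rule allI)
      fix n
      have "p n * p n \<le> p n * 1" using p_pos[of n] p_le1[of n] by (intro mult_left_mono) auto
      then show "real n * (p n)\<^sup>2 \<le> real n * p n"
        by (simp add: power2_eq_square mult_left_mono)
    qed
    show "(\<lambda>n. measure_pmf.prob (bip_graph_cond_pmf n (p n) a b)
               {f. \<bar>kappa n a b f\<bar> > \<epsilon>}) \<longlonglongrightarrow> 0"
    proof (rule Lim_null_comparison)
      have "(\<lambda>n. 32 / (real n * p n) + 2 * 16384 / \<epsilon>\<^sup>2 / (real n * (p n)\<^sup>2)) \<longlonglongrightarrow> 0 + 0"
        by (intro tendsto_add real_tendsto_divide_at_top[OF tendsto_const] np np2)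
      then show "(\<lambda>n. 32 / (real n * p n) + 2 * 16384 / \<epsilon>\<^sup>2 / (real n * (p n)\<^sup>2)) \<longlonglongrightarrow> 0" by simp
      have "\<forall>\<^sub>F n in sequentially. 32 / \<epsilon> \<le> real n * p n"
        using np by (simp add: filterlim_at_top)
      with ev show "\<forall>\<^sub>F n in sequentially.
          norm (measure_pmf.prob (bip_graph_cond_pmf n (p n) a b) {f. \<bar>kappa n a b f\<bar> > \<epsilon>})
            \<le> 32 / (real n * p n) + 2 * 16384 / \<epsilon>\<^sup>2 / (real n * (p n)\<^sup>2)"
      proof eventually_elim
        case (elim n)
        then show ?case
          using bip_model.prob_kappa_far_from_0[of n a b "p n" \<epsilon>] \<epsilon> by simp
      qed
    qed
  }
qed

end
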